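(* Let $p\geq 2$ be an integer, $r=\lceil\log_2(p-1)\rceil$ and $N_r=\binom{\lceil r/2\rceil+1}{2}+\binom{\lfloor r/2\rfloor+1}{2}$. For all integers $m\geq 2N_r+2$ and $0\leq q\leq p-1$, $$\mathrm{forb}(m,3,F(p-q,p,p,p-q))=\mathrm{forb}(m,3,p\cdot K_2)-qN_r$$ if one of the following holds: (i) $p\geq 2^{r-1}+2q+1$; (ii) $p\leq 2^{r-1}+2q$, $qN_r\leq 2^{r-3}$ and $\frac12(\lfloor r/2\rfloor+1)(p-1-2^{r-1})\geq q$. In particular, for every fixed integer $q\geq 0$ this equality holds for all sufficiently large $p$ (and all $m\geq 2N_r+2$).
   Context: An $s$-matrix is a matrix with entries in $\{0,\dots,s-1\}$; simple means no repeated columns; $|A|$ is the number of columns. $F\prec A$ means some submatrix of $A$ is a row/column permutation of $F$. $\mathrm{Avoid}(m,s,F)$ is the set of $m$-rowed simple $s$-matrices avoiding $F$ as a configuration, and $\mathrm{forb}(m,s,F)$ the maximum number of columns of a member of $\mathrm{Avoid}(m,s,F)$. For nonnegative integers $a,b,c,d$, $F(a,b,c,d)$ is the 2-rowed $(0,1)$-matrix consisting of $a$ columns $\binom{0}{0}$, $b$ columns $\binom{1}{0}$, $c$ columns $\binom{0}{1}$ and $d$ columns $\binom{1}{1}$ (top entry first). $K_2$ is the $2\times4$ matrix of all $(0,1)$-columns of length 2 and $p\cdot K_2$ is the concatenation of $p$ copies of it. *)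

theory Defs
  imports Complex_Main
begin

definition ncols :: "nat list list \<Rightarrow> nat" where
  "ncols A = (if A = [] then 0 else length (hd A))"

definition col :: "nat list list \<Rightarrow> nat \<Rightarrow> nat list" where
  "col A j = map (\<lambda>row. row ! j) A"

definition smat :: "nat \<Rightarrow> nat \<Rightarrow> nat \<Rightarrow> nat list list \<Rightarrow> bool" where
  "smat m n s A \<longleftrightarrow> length A = m \<and> (\<forall>row\<in>set A. length row = n \<and> set row \<subseteq> {..<s})"

definition simple :: "nat list list \<Rightarrow> bool" where
  "simple A \<longleftrightarrow> distinct (map (col A) [0..<ncols A])"

text \<open>F is a configuration of A: some submatrix of A is a row/column permutation of F,
  i.e. there are injective maps of the rows and the columns of F into those of A
  preserving entries.\<close>
definition config :: "nat list list \<Rightarrow> nat list list \<Rightarrow> bool" (infix "\<prec>" 50) where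
  "F \<prec> A \<longleftrightarrow> (\<exists>\<rho> \<sigma>.
      inj_on \<rho> {..<length F} \<and> \<rho> ` {..<length F} \<subseteq> {..<length A} \<and>
      inj_on \<sigma> {..<ncols F} \<and> \<sigma> ` {..<ncols F} \<subseteq> {..<ncols A} \<and>
      (\<forall>i<length F. \<forall>j<ncols F. A ! (\<rho> i) ! (\<sigma> j) = F ! i ! j))"

definition Avoid :: "nat \<Rightarrow> nat \<Rightarrow> nat list list \<Rightarrow> nat list list set" where
  "Avoid m s F = {A. smat m (ncols A) s A \<and> simple A \<and> \<not> F \<prec> A}"

definition forb :: "nat \<Rightarrow> nat \<Rightarrow> nat list list \<Rightarrow> nat" where
  "forb m s F = Max (ncols ` Avoid m s F)"

definition Fmat :: "nat \<Rightarrow> nat \<Rightarrow> nat \<Rightarrow> nat \<Rightarrow> nat list list" where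
  "Fmat a b c d =
     [replicate a 0 @ replicate b 1 @ replicate c 0 @ replicate d 1,
      replicate a 0 @ replicate b 0 @ replicate c 1 @ replicate d 1]"

definition pK2 :: "nat \<Rightarrow> nat list list" where
  "pK2 p = [concat (replicate p [0,1,0,1]), concat (replicate p [0,0,1,1])]"

definition rr :: "nat \<Rightarrow> nat" where
  "rr p = nat \<lceil>log 2 (real p - 1)\<rceil>"

definition NN :: "nat \<Rightarrow> nat" where
  "NN r = ((r + 1) div 2 + 1 choose 2) + (r div 2 + 1 choose 2)"

end

theory Submission
  imports Defs
begin

text \<open>Every pair of rows of a matrix avoiding the configuration has a pattern that occurs rarely: at most
  \<open>p - 1\<close> times if it is 01 or 10, at most \<open>p - q - 1\<close> times if it is 00 or 11. For each support \<open>S\<close>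
  (set of rows with entry other than 2) at most \<open>|S| + 1\<close> columns contain none of the rare patterns, and unless
  the rare patterns come from a tree whose oriented edges are the rows this bound fails to be attained for
  \<open>2 ^ (m - 3)\<close> supports. In the tree case the pairs with rare pattern 01 or 10 are the comparable
  pairs of a partial order of the rows. There are at most \<open>2 ^ k\<close> columns that contain the rare pattern of
  such a pair and of no other, where \<open>k\<close> is the number of further rows not strictly between the two; all other columns
  use up the capacity of two pairs. So each incomparable pair costs \<open>q\<close>, and so does each comparable pair with
  \<open>k < r\<close> (in case (ii), several of them together). Comparing the \<open>\<lceil>r/2\<rceil> + 1\<close> lowest with the
  \<open>\<lfloor>r/2\<rfloor> + 1\<close> highest rows shows that this cost is at least \<open>q * NN r\<close>. It is attained by a directed path
  with that many leaves attached to its two ends.\<close>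

subsection \<open>Configurations as counts of patterns\<close>

text \<open>Write \<open>P = p - 1\<close>. Filling every pair of rows to capacity \<open>P\<close>
  gives \<open>base m + P * (m choose 2)\<close>, the value for \<open>p\<close> copies of K_2. For
  \<open>q > 0\<close> there is a conflict. Comparable pairs have the full capacity
  \<open>P\<close>, but in a long chain the i-th lowest and the j-th highest row have only
  \<open>i + j - 2\<close> rows outside them, and once this drops below \<open>r\<close> the at most
  \<open>2 ^ (r - 1) < P\<close> columns of their own cannot fill it. Making rows incomparable near
  the ends removes the shortage but lowers capacities by \<open>q\<close>. A missing column is not a
  full loss, since a column shared by two pairs replaces it at half value; so a pair with
  \<open>k < r\<close> is only sure to cost \<open>(P - 2 ^ (r - 1)) / 2\<close>. Condition (i) says
  that this is at least \<open>q\<close>. Under (ii) it may be smaller; then either one pair with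
  \<open>k \<le> r - 2\<close> pays for everything, or the short pairs are numerous, at least
  \<open>r div 2 + 1\<close> for each missing incomparable pair, and pay together.\<close>

lemma ex_colour_preserving_inj_iff:
  assumes "finite I" "finite J"
  shows "(\<exists>\<sigma>. inj_on \<sigma> I \<and> \<sigma> ` I \<subseteq> J \<and> (\<forall>t\<in>I. v (\<sigma> t) = u t)) \<longleftrightarrow>
         (\<forall>c. card {t \<in> I. u t = c} \<le> card {s \<in> J. v s = c})" (is "?L = ?R")
proof
  assume ?L
  then obtain \<sigma> where s: "inj_on \<sigma> I" "\<sigma> ` I \<subseteq> J" "\<forall>t\<in>I. v (\<sigma> t) = u t" by blast
  show ?R
  proof
    fix c
    show "card {t \<in> I. u t = c} \<le> card {s \<in> J. v s = c}"
      by (rule card_inj_on_le[where f = \<sigma>]) (use s assms in \<open>auto intro: inj_on_subset\<close>)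
  qed
next
  assume ?R
  then have "\<forall>c. \<exists>g. g ` {t \<in> I. u t = c} \<subseteq> {s \<in> J. v s = c} \<and> inj_on g {t \<in> I. u t = c}"
    using assms by (intro allI card_le_inj) auto
  from choice[OF this] obtain g where "\<forall>c. g c ` {t \<in> I. u t = c} \<subseteq> {s \<in> J. v s = c} \<and> inj_on (g c) {t \<in> I. u t = c}"
    by (elim exE)
  then have g: "g c ` {t \<in> I. u t = c} \<subseteq> {s \<in> J. v s = c}" "inj_on (g c) {t \<in> I. u t = c}" for c
    by auto
  define \<sigma> where "\<sigma> t = g (u t) t" for t
  have v: "\<sigma> t \<in> J \<and> v (\<sigma> t) = u t" if "t \<in> I" for t
    using g(1)[of "u t"] that unfolding \<sigma>_def by blast
  moreover have "inj_on \<sigma> I"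
  proof (rule inj_onI)
    fix s t assume st: "s \<in> I" "t \<in> I" "\<sigma> s = \<sigma> t"
    then have "u s = u t" using v[of s] v[of t] by simp
    then show "s = t" using g(2)[of "u t"] st unfolding \<sigma>_def inj_on_def by auto
  qed
  ultimately show ?L by blast
qed

text \<open>Once the two rows are chosen, only the multiplicities of the pairs of entries matter,
  because columns may be permuted freely.\<close>

lemma config_two_rows_iff:
  assumes "length r0 = length r1"
  shows "[r0, r1] \<prec> A \<longleftrightarrow> (\<exists>i<length A. \<exists>j<length A. i \<noteq> j \<and>
    (\<forall>c. length (filter (\<lambda>z. z = c) (zip r0 r1)) \<le> card {t. t < ncols A \<and> (A ! i ! t, A ! j ! t) = c}))"
    (is "_ \<longleftrightarrow> ?R")
proof -
  have two: "{..<Suc (Suc 0)} = {0, 1::nat}" by auto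
  have *: "(\<exists>\<sigma>. inj_on \<sigma> {..<length r0} \<and> \<sigma> ` {..<length r0} \<subseteq> {..<ncols A} \<and>
       (\<forall>t\<in>{..<length r0}. (A ! i ! \<sigma> t, A ! j ! \<sigma> t) = (r0 ! t, r1 ! t))) \<longleftrightarrow>
     (\<forall>c. length (filter (\<lambda>z. z = c) (zip r0 r1)) \<le> card {t. t < ncols A \<and> (A ! i ! t, A ! j ! t) = c})"
    for i j
    by (subst ex_colour_preserving_inj_iff)
       (use assms in \<open>auto simp: length_filter_conv_card cong: conj_cong\<close>)
  have "[r0, r1] \<prec> A \<longleftrightarrow> (\<exists>\<rho> \<sigma>. inj_on \<rho> {0, 1::nat} \<and> \<rho> ` {0, 1} \<subseteq> {..<length A} \<and>
      inj_on \<sigma> {..<length r0} \<and> \<sigma> ` {..<length r0} \<subseteq> {..<ncols A} \<and>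
      (\<forall>t\<in>{..<length r0}. (A ! \<rho> 0 ! \<sigma> t, A ! \<rho> 1 ! \<sigma> t) = (r0 ! t, r1 ! t)))"
    unfolding config_def
    by (intro ex_cong1) (auto simp: ncols_def two less_Suc_eq all_conj_distrib Ball_def)
  also have "\<dots> \<longleftrightarrow> (\<exists>i<length A. \<exists>j<length A. i \<noteq> j \<and> (\<exists>\<sigma>. inj_on \<sigma> {..<length r0} \<and> \<sigma> ` {..<length r0} \<subseteq> {..<ncols A} \<and>
       (\<forall>t\<in>{..<length r0}. (A ! i ! \<sigma> t, A ! j ! \<sigma> t) = (r0 ! t, r1 ! t))))" (is "?P \<longleftrightarrow> ?Q")
  proof
    assume ?P
    then obtain \<rho> \<sigma> where h: "inj_on \<rho> {0, 1::nat}" "\<rho> ` {0, 1} \<subseteq> {..<length A}"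
      "inj_on \<sigma> {..<length r0}" "\<sigma> ` {..<length r0} \<subseteq> {..<ncols A}"
      "\<forall>t\<in>{..<length r0}. (A ! \<rho> 0 ! \<sigma> t, A ! \<rho> 1 ! \<sigma> t) = (r0 ! t, r1 ! t)" by blast
    have "\<rho> 0 < length A" "\<rho> 1 < length A" "\<rho> 0 \<noteq> \<rho> 1" using h(1,2) by (auto simp: inj_on_def)
    then show ?Q using h(3-5) by blast
  next
    assume ?Q
    then obtain i j \<sigma> where h: "i < length A" "j < length A" "i \<noteq> j"
      "inj_on \<sigma> {..<length r0}" "\<sigma> ` {..<length r0} \<subseteq> {..<ncols A}"
      "\<forall>t\<in>{..<length r0}. (A ! i ! \<sigma> t, A ! j ! \<sigma> t) = (r0 ! t, r1 ! t)" by blast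
    show ?P by (rule exI[of _ "\<lambda>k. if k = 0 then i else j"], rule exI[of _ \<sigma>]) (use h in auto)
  qed
  finally show ?thesis unfolding * .
qed

section \<open>Sets of columns in place of simple matrices\<close>

definition columns :: "nat \<Rightarrow> nat list set" where
  "columns m = {x. length x = m \<and> set x \<subseteq> {..<3}}"

definition pattern_count :: "nat list set \<Rightarrow> nat \<Rightarrow> nat \<Rightarrow> nat \<Rightarrow> nat \<Rightarrow> nat" where
  "pattern_count C i j u v = card {x \<in> C. x ! i = u \<and> x ! j = v}"

definition contains :: "nat \<Rightarrow> nat \<Rightarrow> nat \<Rightarrow> nat \<Rightarrow> nat \<Rightarrow> nat list set \<Rightarrow> bool" where
  "contains m a b c d C \<longleftrightarrow> (\<exists>i<m. \<exists>j<m. i \<noteq> j \<and> a \<le> pattern_count C i j 0 0 \<and>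
     b \<le> pattern_count C i j 1 0 \<and> c \<le> pattern_count C i j 0 1 \<and> d \<le> pattern_count C i j 1 1)"

lemma finite_columns: "finite (columns m)"
proof -
  have "columns m = {x. set x \<subseteq> {..<3} \<and> length x = m}" unfolding columns_def by auto
  then show ?thesis by (simp add: finite_lists_length_eq)
qed

lemma filter_zip_Fmat:
  "length (filter (\<lambda>z. z = w) (zip (replicate a (0::nat) @ replicate b 1 @ replicate c 0 @ replicate d 1)
      (replicate a (0::nat) @ replicate b 0 @ replicate c 1 @ replicate d 1))) =
   (if w = (0, 0) then a else if w = (1, 0) then b else if w = (0, 1) then c
    else if w = (1, 1) then d else 0)"
  by (simp add: filter_replicate)

lemma filter_zip_pK2:
  "length (filter (\<lambda>z. z = w) (zip (concat (replicate p [0::nat, 1, 0, 1])) (concat (replicate p [0::nat, 0, 1, 1])))) =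
   (if w = (0, 0) then p else if w = (1, 0) then p else if w = (0, 1) then p
    else if w = (1, 1) then p else 0)"
  by (induction p) auto

lemma all_pattern_le_iff:
  "(\<forall>w. (if w = (0, 0) then a else if w = (1, 0) then b else if w = (0, 1) then c
    else if w = (1, 1) then d else 0) \<le> g w) \<longleftrightarrow>
   a \<le> g (0::nat, 0::nat) \<and> b \<le> g (1, 0) \<and> c \<le> g (0, 1) \<and> (d::nat) \<le> g (1, 1)"
  (is "(\<forall>w. ?h w \<le> _) \<longleftrightarrow> _")
proof
  assume *: "\<forall>w. ?h w \<le> g w"
  show "a \<le> g (0, 0) \<and> b \<le> g (1, 0) \<and> c \<le> g (0, 1) \<and> d \<le> g (1, 1)"
    using *[rule_format, of "(0, 0)"] *[rule_format, of "(1, 0)"] *[rule_format, of "(0, 1)"]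
      *[rule_format, of "(1, 1)"] by simp
qed simp

lemma config_Fmat_iff:
  "Fmat a b c d \<prec> A \<longleftrightarrow> (\<exists>i<length A. \<exists>j<length A. i \<noteq> j \<and>
     a \<le> card {t. t < ncols A \<and> (A ! i ! t, A ! j ! t) = (0, 0)} \<and>
     b \<le> card {t. t < ncols A \<and> (A ! i ! t, A ! j ! t) = (1, 0)} \<and>
     c \<le> card {t. t < ncols A \<and> (A ! i ! t, A ! j ! t) = (0, 1)} \<and>
     d \<le> card {t. t < ncols A \<and> (A ! i ! t, A ! j ! t) = (1, 1)})"
  unfolding Fmat_def
  by (subst config_two_rows_iff, simp, subst filter_zip_Fmat, subst all_pattern_le_iff) simp

lemma config_pK2_iff: "pK2 p \<prec> A \<longleftrightarrow> Fmat p p p p \<prec> A"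
proof -
  have "length (concat (replicate p [0::nat, 1, 0, 1])) = length (concat (replicate p [0::nat, 0, 1, 1]))"
    by (induction p) auto
  then show ?thesis unfolding Fmat_def pK2_def
    by (simp only: config_two_rows_iff filter_zip_pK2 filter_zip_Fmat length_append length_replicate)
qed

lemma forb_pK2: "forb m s (pK2 p) = forb m s (Fmat p p p p)"
  unfolding forb_def Avoid_def config_pK2_iff ..

text \<open>Up to the order of its columns a simple matrix is a set of columns, so
  \<open>forb\<close> becomes a maximum over subsets of the finite set
  \<open>columns m\<close>.\<close>

lemma ncols_Avoid_Fmat:
  assumes "m > 0"
  shows "ncols ` Avoid m 3 (Fmat a b c d) = card ` {C. C \<subseteq> columns m \<and> \<not> contains m a b c d C}"
proof (intro subset_antisym subsetI)
  fix n assume "n \<in> ncols ` Avoid m 3 (Fmat a b c d)"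
  then obtain A where A: "smat m (ncols A) 3 A" "simple A" "\<not> Fmat a b c d \<prec> A" "n = ncols A"
    unfolding Avoid_def by auto
  have len: "length A = m" and row: "\<And>i. i < m \<Longrightarrow> length (A ! i) = n \<and> set (A ! i) \<subseteq> {..<3}"
    using A(1,4) unfolding smat_def by (auto dest: nth_mem)
  have inj: "inj_on (col A) {..<n}"
    using A(2) unfolding simple_def A(4) distinct_map by (simp add: atLeast0LessThan)
  define C where "C = col A ` {..<n}"
  have nth: "col A t ! i = A ! i ! t" if "i < m" for i t
    unfolding col_def using that len by simp
  have cnt: "card {t. t < ncols A \<and> (A ! i ! t, A ! j ! t) = (u, v)} = pattern_count C i j u v"
    if "i < m" "j < m" for i j u v
  proof -
    have "{x \<in> C. x ! i = u \<and> x ! j = v} = col A ` {t. t < ncols A \<and> (A ! i ! t, A ! j ! t) = (u, v)}"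
      unfolding C_def A(4) using nth that by auto
    then show ?thesis unfolding pattern_count_def
      by (simp only:) (rule card_image[symmetric], rule inj_on_subset[OF inj], auto simp: A(4))
  qed
  have "C \<subseteq> columns m"
  proof
    fix x assume "x \<in> C"
    then obtain t where t: "t < n" "x = col A t" unfolding C_def by auto
    have "x ! i < 3" if "i < m" for i
      using row[OF that] nth[OF that] t nth_mem[of t "A ! i"] by (metis lessThan_iff subsetD)
    then show "x \<in> columns m" unfolding columns_def t(2) col_def
      using len by (auto simp: in_set_conv_nth)
  qed
  moreover have "\<not> contains m a b c d C"
    using A(3) unfolding config_Fmat_iff contains_def len using cnt by auto
  moreover have "n = card C" unfolding C_def using card_image[OF inj] by simp
  ultimately show "n \<in> card ` {C. C \<subseteq> columns m \<and> \<not> contains m a b c d C}" by blast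
next
  fix n assume "n \<in> card ` {C. C \<subseteq> columns m \<and> \<not> contains m a b c d C}"
  then obtain C where C: "C \<subseteq> columns m" "\<not> contains m a b c d C" "n = card C" by auto
  have "finite C" using C(1) finite_columns finite_subset by blast
  then obtain cs where cs: "set cs = C" "distinct cs" using finite_distinct_list by blast
  have n: "length cs = n" using C(3) cs distinct_card by fastforce
  define A where "A = map (\<lambda>i. map (\<lambda>x. x ! i) cs) [0..<m]"
  have len: "length A = m" and nth: "\<And>i. i < m \<Longrightarrow> A ! i = map (\<lambda>x. x ! i) cs" unfolding A_def by auto
  \<comment> \<open>\<open>ncols\<close> is read off the first row, so \<open>m > 0\<close> matters:
    a matrix without rows has \<open>ncols\<close> 0, while \<open>columns 0\<close> contains the
    empty list.\<close>
  have nc: "ncols A = n" unfolding ncols_def A_def using assms n by (simp add: hd_map)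
  have xl: "length x = m" "set x \<subseteq> {..<3}" if "x \<in> C" for x using that C(1) unfolding columns_def by auto
  have colA: "col A t = cs ! t" if "t < n" for t
    by (rule nth_equalityI) (use that n cs xl[of "cs ! t"] len nth in \<open>auto simp: col_def\<close>)
  have "smat m (ncols A) 3 A" unfolding smat_def
  proof (intro conjI ballI)
    fix row assume "row \<in> set A"
    then obtain i where i: "i < m" "row = map (\<lambda>x. x ! i) cs" unfolding A_def by auto
    show "length row = ncols A" using i n nc by simp
    show "set row \<subseteq> {..<3}" using i xl cs nth_mem by fastforce
  qed (rule len)
  moreover have "simple A"
  proof -
    have "map (col A) [0..<ncols A] = cs" by (rule nth_equalityI) (use nc n colA in auto)
    then show ?thesis unfolding simple_def using cs by simp
  qed
  moreover have "\<not> Fmat a b c d \<prec> A"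
  proof -
    have cnt: "card {t. t < ncols A \<and> (A ! i ! t, A ! j ! t) = (u, v)} = pattern_count C i j u v"
      if "i < m" "j < m" for i j u v
    proof -
      have "{x \<in> C. x ! i = u \<and> x ! j = v} = (!) cs ` {t. t < ncols A \<and> (A ! i ! t, A ! j ! t) = (u, v)}"
        using nth[OF that(1)] nth[OF that(2)] nc n cs by (auto simp: in_set_conv_nth)
      moreover have "inj_on ((!) cs) {t. t < ncols A \<and> (A ! i ! t, A ! j ! t) = (u, v)}"
        by (rule inj_on_nth) (use cs nc n in auto)
      ultimately show ?thesis unfolding pattern_count_def by (simp add: card_image)
    qed
    show ?thesis using C(2) unfolding config_Fmat_iff contains_def len
      by (simp add: cnt cong: conj_cong del: prod.inject)
  qed
  ultimately show "n \<in> ncols ` Avoid m 3 (Fmat a b c d)"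
    unfolding Avoid_def using nc by (auto intro!: image_eqI[of _ _ A])
qed

subsection \<open>An inequality for capped sums\<close>

text \<open>In decreasing order, the values are at most \<open>card X - 1, card X - 2, \<dots>, 0\<close>.\<close>
definition capped :: "'a set \<Rightarrow> ('a \<Rightarrow> int) \<Rightarrow> bool" where
  "capped X \<alpha> \<longleftrightarrow> (\<forall>v\<ge>0. int (card {x \<in> X. v \<le> \<alpha> x}) \<le> max 0 (int (card X) - v))"

text \<open>In the application \<open>X\<close> and \<open>Y\<close> are the lowest and the highest
  rows, and at most \<open>r - (\<alpha> x + \<beta> y)\<close> rows lie outside the pair
  \<open>x, y\<close>. So cells are comparable pairs that cannot be filled by columns of their
  own.\<close>

definition cells :: "'a set \<Rightarrow> ('a \<Rightarrow> int) \<Rightarrow> 'b set \<Rightarrow> ('b \<Rightarrow> int) \<Rightarrow> ('a \<times> 'b) set" where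
  "cells X \<alpha> Y \<beta> = {(x, y). x \<in> X \<and> y \<in> Y \<and> 1 \<le> \<alpha> x + \<beta> y}"

lemma card_cells_swap: "card (cells X \<alpha> Y \<beta>) = card (cells Y \<beta> X \<alpha>)"
proof -
  have "cells Y \<beta> X \<alpha> = prod.swap ` cells X \<alpha> Y \<beta>" by (force simp: cells_def)
  then show ?thesis by (simp add: card_image)
qed

lemma finite_cells: "finite X \<Longrightarrow> finite Y \<Longrightarrow> finite (cells X \<alpha> Y \<beta>)"
  by (rule finite_subset[of _ "X \<times> Y"]) (auto simp: cells_def)

lemma finite_ex_argmax:
  fixes f :: "'a \<Rightarrow> int"
  assumes "finite X" "X \<noteq> {}"
  obtains x where "x \<in> X" "\<And>y. y \<in> X \<Longrightarrow> f y \<le> f x"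
proof -
  have "Max (f ` X) \<in> f ` X" using assms by (intro Max_in) auto
  then obtain x where x: "x \<in> X" "Max (f ` X) = f x" by blast
  show thesis by (rule that[OF x(1)]) (use assms x(2) Max_ge[of "f ` X"] in auto)
qed

lemma capped_less:
  assumes "capped X \<alpha>" "finite X" "x \<in> X"
  shows "\<alpha> x \<le> int (card X) - 1"
proof (rule ccontr)
  assume "\<not> ?thesis"
  then have "x \<in> {x \<in> X. int (card X) \<le> \<alpha> x}" using assms(3) by simp
  then have "card {x \<in> X. int (card X) \<le> \<alpha> x} > 0" using assms(2) card_gt_0_iff by fastforce
  moreover have "int (card {x \<in> X. int (card X) \<le> \<alpha> x}) \<le> max 0 (int (card X) - int (card X))"
    using assms(1) unfolding capped_def by (metis of_nat_0_le_iff)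
  ultimately show False by simp
qed

text \<open>At levels up to the maximum both the count and its cap drop by one; at higher levels
  nothing is left to count.\<close>

lemma capped_remove_max:
  assumes "capped X \<alpha>" "finite X" "x0 \<in> X" "\<And>x. x \<in> X \<Longrightarrow> \<alpha> x \<le> \<alpha> x0"
  shows "capped (X - {x0}) \<alpha>"
  unfolding capped_def
proof (intro allI impI)
  fix v :: int assume v: "0 \<le> v"
  have c: "int (card (X - {x0})) = int (card X) - 1"
    using assms(2,3) by (metis card_Diff_singleton card_gt_0_iff empty_iff of_nat_diff One_nat_def Suc_leI of_nat_1)
  show "int (card {x \<in> X - {x0}. v \<le> \<alpha> x}) \<le> max 0 (int (card (X - {x0})) - v)"
  proof (cases "v \<le> \<alpha> x0")
    case True
    have "{x \<in> X - {x0}. v \<le> \<alpha> x} = {x \<in> X. v \<le> \<alpha> x} - {x0}" by auto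
    moreover have "x0 \<in> {x \<in> X. v \<le> \<alpha> x}" using True assms(3) by auto
    moreover have f: "finite {x \<in> X. v \<le> \<alpha> x}" using assms(2) by auto
    ultimately have "Suc (card {x \<in> X - {x0}. v \<le> \<alpha> x}) = card {x \<in> X. v \<le> \<alpha> x}"
      by (metis card_Suc_Diff1)
    then have "int (card {x \<in> X - {x0}. v \<le> \<alpha> x}) + 1 = int (card {x \<in> X. v \<le> \<alpha> x})" by linarith
    moreover have "int (card {x \<in> X. v \<le> \<alpha> x}) \<le> max 0 (int (card X) - v)"
      using assms(1) v unfolding capped_def by blast
    ultimately show ?thesis unfolding c by linarith
  next
    case False
    then have "{x \<in> X - {x0}. v \<le> \<alpha> x} = {}" using assms(4) by force
    then show ?thesis by (simp only: card.empty)
  qed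
qed

text \<open>If row \<open>x0\<close> is not full, delete it together with the largest column \<open>y1\<close> outside it
  (\<open>\<alpha> x0 + \<beta> y1 \<le> 0\<close>); the cells of the row pay for lowering the values of its columns by one,
  which restores the caps.\<close>
lemma capped_remove_lower:
  assumes "capped Y \<beta>" "finite Y" "y1 \<in> Y" "\<beta> y1 < c"
    and max: "\<And>y. y \<in> Y \<Longrightarrow> \<beta> y < c \<Longrightarrow> \<beta> y \<le> \<beta> y1"
  shows "capped (Y - {y1}) (\<lambda>y. if c \<le> \<beta> y then \<beta> y - 1 else \<beta> y)"
  unfolding capped_def
proof (intro allI impI)
  fix v :: int assume v: "0 \<le> v"
  let ?b = "\<lambda>y. if c \<le> \<beta> y then \<beta> y - 1 else \<beta> y"
  let ?S = "{y \<in> Y - {y1}. v \<le> ?b y}"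
  have c: "int (card (Y - {y1})) = int (card Y) - 1"
    using assms(2,3) by (metis card_Diff_singleton card_gt_0_iff empty_iff of_nat_diff One_nat_def Suc_leI of_nat_1)
  show "int (card ?S) \<le> max 0 (int (card (Y - {y1})) - v)"
  proof (cases "v \<le> \<beta> y1")
    case True
    have f: "finite {y \<in> Y. v \<le> \<beta> y}" using assms(2) by auto
    have "?S \<subseteq> {y \<in> Y. v \<le> \<beta> y} - {y1}" by (auto split: if_splits)
    then have "card ?S \<le> card ({y \<in> Y. v \<le> \<beta> y} - {y1})" using f by (intro card_mono) auto
    moreover have "Suc (card ({y \<in> Y. v \<le> \<beta> y} - {y1})) = card {y \<in> Y. v \<le> \<beta> y}"
      using True assms(3) f by (intro card_Suc_Diff1) auto
    moreover have "int (card {y \<in> Y. v \<le> \<beta> y}) \<le> max 0 (int (card Y) - v)"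
      using assms(1) v unfolding capped_def by blast
    ultimately show ?thesis unfolding c by linarith
  next
    case False
    have "?S \<subseteq> {y \<in> Y. v + 1 \<le> \<beta> y}" using max False by (force split: if_splits)
    then have "card ?S \<le> card {y \<in> Y. v + 1 \<le> \<beta> y}" using assms(2) by (intro card_mono) auto
    moreover have "int (card {y \<in> Y. v + 1 \<le> \<beta> y}) \<le> max 0 (int (card Y) - (v + 1))"
      using assms(1) v unfolding capped_def by (meson add_nonneg_nonneg zero_le_one)
    ultimately show ?thesis unfolding c by linarith
  qed
qed

lemma card_cells_remove_row:
  assumes "finite X" "finite Y" "x0 \<in> X"
  shows "card (cells X \<alpha> Y \<beta>) = card {y \<in> Y. 1 \<le> \<alpha> x0 + \<beta> y} + card (cells (X - {x0}) \<alpha> Y \<beta>)"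
proof -
  have "cells X \<alpha> Y \<beta> = Pair x0 ` {y \<in> Y. 1 \<le> \<alpha> x0 + \<beta> y} \<union> cells (X - {x0}) \<alpha> Y \<beta>"
    using assms(3) unfolding cells_def by auto
  moreover have "card (Pair x0 ` {y \<in> Y. 1 \<le> \<alpha> x0 + \<beta> y} \<union> cells (X - {x0}) \<alpha> Y \<beta>) =
     card (Pair x0 ` {y \<in> Y. 1 \<le> \<alpha> x0 + \<beta> y}) + card (cells (X - {x0}) \<alpha> Y \<beta>)"
    by (rule card_Un_disjoint) (use assms in \<open>auto simp: finite_cells\<close>, auto simp: cells_def)
  ultimately show ?thesis by (simp add: card_image inj_on_def)
qed

text \<open>Induction that removes the row \<open>x0\<close> of largest value from the larger side.
  If that row is full, its \<open>card Y \<ge> card X - 1 \<ge> \<alpha> x0\<close> cells pay for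
  \<open>\<alpha> x0\<close>; here the two sizes must differ by at most one. If not, a column is
  removed with it, as in \<open>capped_remove_lower\<close>.\<close>

lemma sum_le_card_cells:
  fixes X :: "'a set" and Y :: "'a set"
  assumes "finite X" "finite Y" "card X \<le> card Y + 1" "card Y \<le> card X + 1" "capped X \<alpha>" "capped Y \<beta>"
  shows "sum \<alpha> X + sum \<beta> Y \<le> int (card (cells X \<alpha> Y \<beta>))"
  using assms
proof (induction "card X + card Y" arbitrary: X Y \<alpha> \<beta> rule: less_induct)
  case less
  show ?case
  proof -
    \<comment> \<open>The induction hypothesis is made a premise so that the case
      \<open>card X < card Y\<close> follows by exchanging the two sides.\<close>
    have main: "sum \<alpha> X + sum \<beta> Y \<le> int (card (cells X \<alpha> Y \<beta>))"
      if P: "finite X" "finite Y" "card Y \<le> card X" "card X \<le> card Y + 1" "capped X \<alpha>" "capped Y \<beta>"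
        and IH: "\<And>X' Y' \<alpha> \<beta>. card X' + card Y' < card X + card Y \<Longrightarrow> finite (X'::'a set) \<Longrightarrow> finite (Y'::'a set) \<Longrightarrow>
          card X' \<le> card Y' + 1 \<Longrightarrow> card Y' \<le> card X' + 1 \<Longrightarrow> capped X' \<alpha> \<Longrightarrow> capped Y' \<beta> \<Longrightarrow>
          sum \<alpha> X' + sum \<beta> Y' \<le> int (card (cells X' \<alpha> Y' \<beta>))"
      for X Y :: "'a set" and \<alpha> \<beta>
    proof (cases "X = {}")
      case True
      then have "Y = {}" using P by simp
      then show ?thesis using True by simp
    next
      case False
      obtain x0 where x0: "x0 \<in> X" "\<And>x. x \<in> X \<Longrightarrow> \<alpha> x \<le> \<alpha> x0"
        using finite_ex_argmax[OF P(1) False, of \<alpha> thesis] by simp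
      define N where "N = {y \<in> Y. 1 \<le> \<alpha> x0 + \<beta> y}"
      have cX: "card X = Suc (card (X - {x0}))" using x0(1) P(1) by (metis card_Suc_Diff1)
      have rem: "card (cells X \<alpha> Y \<beta>) = card N + card (cells (X - {x0}) \<alpha> Y \<beta>)"
        unfolding N_def by (rule card_cells_remove_row) (use P x0 in auto)
      have cap': "capped (X - {x0}) \<alpha>" by (rule capped_remove_max[OF P(5,1) x0])
      have sX: "sum \<alpha> X = \<alpha> x0 + sum \<alpha> (X - {x0})" using P(1) x0(1) by (simp add: sum.remove)
      show ?thesis
      proof (cases "N = Y")
        case True
        have "sum \<alpha> (X - {x0}) + sum \<beta> Y \<le> int (card (cells (X - {x0}) \<alpha> Y \<beta>))"
          by (rule IH) (use P cX cap' in auto)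
        moreover have "\<alpha> x0 \<le> int (card X) - 1" by (rule capped_less[OF P(5,1) x0(1)])
        moreover have "int (card (cells X \<alpha> Y \<beta>)) = int (card Y) + int (card (cells (X - {x0}) \<alpha> Y \<beta>))"
          using rem True by simp
        ultimately show ?thesis using P(4) sX by linarith
      next
        case False
        then have ne: "Y - N \<noteq> {}" unfolding N_def by auto
        obtain y1 where y1: "y1 \<in> Y - N" "\<And>y. y \<in> Y - N \<Longrightarrow> \<beta> y \<le> \<beta> y1"
          using finite_ex_argmax[OF finite_Diff[OF P(2)] ne, of \<beta> thesis] by simp
        define \<beta>' where "\<beta>' y = (if 1 - \<alpha> x0 \<le> \<beta> y then \<beta> y - 1 else \<beta> y)" for y
        have capY: "capped (Y - {y1}) \<beta>'" unfolding \<beta>'_def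
          by (rule capped_remove_lower) (use P y1 in \<open>auto simp: N_def\<close>)
        have cY: "card Y = Suc (card (Y - {y1}))" using y1(1) P(2) by (metis DiffD1 card_Suc_Diff1)
        have "sum \<alpha> (X - {x0}) + sum \<beta>' (Y - {y1}) \<le> int (card (cells (X - {x0}) \<alpha> (Y - {y1}) \<beta>'))"
          by (rule IH) (use P cX cY cap' capY in auto)
        moreover have "card (cells (X - {x0}) \<alpha> (Y - {y1}) \<beta>') \<le> card (cells (X - {x0}) \<alpha> Y \<beta>)"
          by (rule card_mono) (use P in \<open>auto simp: finite_cells\<close>, auto simp: cells_def \<beta>'_def split: if_splits)
        moreover have "sum \<beta> Y = \<beta> y1 + sum \<beta>' (Y - {y1}) + int (card N)"
        proof -
          have "sum \<beta> Y = \<beta> y1 + sum \<beta> (Y - {y1})" using P(2) y1(1) by (simp add: sum.remove)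
          also have "sum \<beta> (Y - {y1}) = (\<Sum>y\<in>Y - {y1}. \<beta>' y + (if y \<in> N then 1 else 0))"
            by (rule sum.cong) (auto simp: \<beta>'_def N_def)
          also have "\<dots> = sum \<beta>' (Y - {y1}) + int (card N)"
          proof -
            have "(Y - {y1}) \<inter> N = N" using y1 unfolding N_def by auto
            then show ?thesis using P(2) by (simp add: sum.distrib sum.If_cases)
          qed
          finally show ?thesis by simp
        qed
        moreover have "\<alpha> x0 + \<beta> y1 \<le> 0" using y1 unfolding N_def by auto
        moreover have "int (card (cells X \<alpha> Y \<beta>)) = int (card N) + int (card (cells (X - {x0}) \<alpha> Y \<beta>))"
          using rem by simp
        ultimately show ?thesis using sX by linarith
      qed
    qed
    show ?thesis
    proof (cases "card Y \<le> card X")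
      case True
      show ?thesis by (rule main) (use less True in auto)
    next
      case False
      have "sum \<beta> Y + sum \<alpha> X \<le> int (card (cells Y \<beta> X \<alpha>))"
      proof (rule main)
        fix X' Y' :: "'a set" and \<alpha>' \<beta>'
        assume "card X' + card Y' < card Y + card X" "finite X'" "finite Y'"
          "card X' \<le> card Y' + 1" "card Y' \<le> card X' + 1" "capped X' \<alpha>'" "capped Y' \<beta>'"
        then show "sum \<alpha>' X' + sum \<beta>' Y' \<le> int (card (cells X' \<alpha>' Y' \<beta>'))"
          using less.hyps[of X' Y' \<alpha>' \<beta>'] by simp
      qed (use less.prems False in auto)
      then show ?thesis by (simp add: card_cells_swap[of X] add.commute)
    qed
  qed
qed

lemma scaled_sum_le_card_cells:
  assumes fin: "finite X" "finite Y" and "card X = card Y \<or> card X = card Y + 1" and "capped X \<alpha>"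
    and le1: "\<And>x y. x \<in> X \<Longrightarrow> y \<in> Y \<Longrightarrow> \<alpha> x + \<beta> y \<le> 1"
  shows "int (card Y) * (sum \<alpha> X + sum \<beta> Y) \<le> int (card (cells X \<alpha> Y \<beta>))"
proof -
  have eq: "int (card Y) * (sum \<alpha> Z + sum \<beta> Y) \<le> int (card (cells X \<alpha> Y \<beta>))"
    if Z: "Z \<subseteq> X" "card Z = card Y" for Z
  proof -
    have fZ: "finite Z" using Z fin finite_subset by blast
    have "int (card Y) * (sum \<alpha> Z + sum \<beta> Y) = (\<Sum>x\<in>Z. \<Sum>y\<in>Y. \<alpha> x + \<beta> y)"
      using Z(2) by (simp add: sum.distrib distrib_left flip: sum_distrib_left)
    also have "\<dots> \<le> (\<Sum>x\<in>Z. \<Sum>y\<in>Y. if (x, y) \<in> cells X \<alpha> Y \<beta> then 1 else 0)"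
      using le1 Z by (intro sum_mono) (auto simp: cells_def)
    also have "\<dots> = (\<Sum>z\<in>Z \<times> Y. if z \<in> cells X \<alpha> Y \<beta> then 1 else 0)"
      by (simp add: sum.cartesian_product case_prod_unfold)
    also have "\<dots> = int (card ((Z \<times> Y) \<inter> cells X \<alpha> Y \<beta>))"
      using fZ fin by (subst sum.inter_restrict[symmetric]) auto
    also have "\<dots> \<le> int (card (cells X \<alpha> Y \<beta>))"
      using fin by (simp add: card_mono finite_cells)
    finally show ?thesis .
  qed
  show ?thesis
  proof (cases "card X = card Y")
    case True then show ?thesis using eq[of X] by simp
  next
    case False
    then have c: "card X = card Y + 1" using assms by blast
    have "\<exists>x\<in>X. \<alpha> x \<le> 0"
    proof (rule ccontr)
      assume "\<not> ?thesis"
      then have "{x \<in> X. 1 \<le> \<alpha> x} = X" by force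
      then have "int (card X) \<le> max 0 (int (card X) - 1)"
        using assms(4) unfolding capped_def by (metis zero_le_one)
      then show False using c by simp
    qed
    then obtain x where x: "x \<in> X" "\<alpha> x \<le> 0" by blast
    have "int (card Y) * (sum \<alpha> (X - {x}) + sum \<beta> Y) \<le> int (card (cells X \<alpha> Y \<beta>))"
      by (rule eq) (use c x fin in auto)
    moreover have "sum \<alpha> X = \<alpha> x + sum \<alpha> (X - {x})" using x fin by (simp add: sum.remove)
    moreover have "int (card Y) * (\<alpha> x + sum \<alpha> (X - {x}) + sum \<beta> Y) \<le> int (card Y) * (sum \<alpha> (X - {x}) + sum \<beta> Y)"
      using x(2) by (intro mult_left_mono) auto
    ultimately show ?thesis by simp
  qed
qed

subsection \<open>Columns satisfying all pairwise restrictions\<close>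

text \<open>The pair \<open>i, j\<close> has the forbidden pattern \<open>(f i j, f j i)\<close>.\<close>
definition satisfies :: "(nat \<Rightarrow> nat \<Rightarrow> bool) \<Rightarrow> nat set \<Rightarrow> nat set \<Rightarrow> bool" where
  "satisfies f S X \<longleftrightarrow> (\<forall>i\<in>S. \<forall>j\<in>S. i \<noteq> j \<longrightarrow> \<not> ((i \<in> X) = f i j \<and> (j \<in> X) = f j i))"

lemma satisfies_subset: "satisfies f S X \<Longrightarrow> T \<subseteq> S \<Longrightarrow> satisfies f T (X \<inter> T)"
  unfolding satisfies_def by blast

text \<open>A trace with two sets extending to both sides of \<open>s\<close> would realise all four patterns on
  \<open>s\<close> and any element separating the two sets.\<close>
lemma card_trace_insert:
  assumes "finite S" "s \<notin> S" "\<F> \<subseteq> Pow (insert s S)" "\<And>X. X \<in> \<F> \<Longrightarrow> satisfies f (insert s S) X"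
  shows "card \<F> \<le> card ((\<lambda>X. X \<inter> S) ` \<F>) + 1"
proof -
  let ?r = "\<lambda>X. X \<inter> S"
  define F0 where "F0 = {X \<in> \<F>. s \<notin> X}"
  define F1 where "F1 = {X \<in> \<F>. s \<in> X}"
  have fin: "finite \<F>" using assms(1,3) by (meson finite_Pow_iff finite_insert finite_subset)
  have sub: "X \<subseteq> insert s S" if "X \<in> \<F>" for X using assms(3) that by auto
  have i0: "inj_on ?r F0"
  proof (rule inj_onI)
    fix X Y assume h: "X \<in> F0" "Y \<in> F0" "X \<inter> S = Y \<inter> S"
    have "X \<subseteq> S" "Y \<subseteq> S" using h sub[of X] sub[of Y] unfolding F0_def by auto
    then show "X = Y" using h(3) by blast
  qed
  have i1: "inj_on ?r F1"
  proof (rule inj_onI)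
    fix X Y assume h: "X \<in> F1" "Y \<in> F1" "X \<inter> S = Y \<inter> S"
    have "X = insert s (X \<inter> S)" "Y = insert s (Y \<inter> S)" using h sub[of X] sub[of Y] unfolding F1_def by auto
    then show "X = Y" using h(3) by simp
  qed
  have "\<F> = F0 \<union> F1" "F0 \<inter> F1 = {}" unfolding F0_def F1_def by auto
  then have "card \<F> = card F0 + card F1" using fin card_Un_disjoint[of F0 F1] by simp
  also have "\<dots> = card (?r ` F0) + card (?r ` F1)" using i0 i1 by (simp add: card_image)
  also have "\<dots> = card (?r ` F0 \<union> ?r ` F1) + card (?r ` F0 \<inter> ?r ` F1)"
    by (rule card_Un_Int) (use fin in \<open>auto simp: F0_def F1_def\<close>)
  also have "?r ` F0 \<union> ?r ` F1 = ?r ` \<F>" using \<open>\<F> = F0 \<union> F1\<close> by (simp add: image_Un)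
  also have "card (?r ` F0 \<inter> ?r ` F1) \<le> 1"
  proof -
    have "U = V" if UV: "U \<in> ?r ` F0 \<inter> ?r ` F1" "V \<in> ?r ` F0 \<inter> ?r ` F1" for U V
    proof (rule ccontr)
      assume "U \<noteq> V"
      moreover have "U \<subseteq> S" "V \<subseteq> S" using UV by auto
      ultimately obtain j where j: "j \<in> S" "(j \<in> U) \<noteq> (j \<in> V)" by blast
      obtain U0 U1 where U: "U0 \<in> F0" "U1 \<in> F1" "U = U0 \<inter> S" "U = U1 \<inter> S" using UV(1) by blast
      obtain V0 V1 where V: "V0 \<in> F0" "V1 \<in> F1" "V = V0 \<inter> S" "V = V1 \<inter> S" using UV(2) by blast
      have *: "\<not> ((s \<in> X) = f s j \<and> (j \<in> X) = f j s)" if "X \<in> \<F>" for X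
      proof -
        have "s \<noteq> j" using j(1) assms(2) by blast
        then show ?thesis using assms(4)[OF that] j(1) unfolding satisfies_def by blast
      qed
      have "U0 \<in> \<F>" "U1 \<in> \<F>" "V0 \<in> \<F>" "V1 \<in> \<F>" using U(1,2) V(1,2) unfolding F0_def F1_def by auto
      note ** = this[THEN *]
      have "s \<notin> U0" "s \<notin> V0" "s \<in> U1" "s \<in> V1" using U(1,2) V(1,2) unfolding F0_def F1_def by auto
      moreover have "(j \<in> U0) = (j \<in> U)" "(j \<in> U1) = (j \<in> U)" "(j \<in> V0) = (j \<in> V)" "(j \<in> V1) = (j \<in> V)"
        using U(3,4) V(3,4) j(1) by auto
      ultimately show False using ** j(2) by simp
    qed
    moreover have "finite (?r ` F0 \<inter> ?r ` F1)" using fin unfolding F0_def by simp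
    ultimately show ?thesis unfolding One_nat_def by (subst card_le_Suc0_iff_eq) blast+
  qed
  finally show ?thesis by simp
qed

text \<open>Each further row adds at most one set, so a bound for the trace on \<open>S0\<close>
  carries over to \<open>S0 \<union> D\<close>. It is applied to an empty \<open>S0\<close> and to a
  triple of rows.\<close>

lemma card_trace:
  assumes "finite D" "finite S0" "D \<inter> S0 = {}" "\<F> \<subseteq> Pow (S0 \<union> D)"
    "\<And>X. X \<in> \<F> \<Longrightarrow> satisfies f (S0 \<union> D) X"
  shows "card \<F> \<le> card ((\<lambda>X. X \<inter> S0) ` \<F>) + card D"
  using assms
proof (induction D arbitrary: \<F> rule: finite_induct)
  case empty
  have "X \<inter> S0 = X" if "X \<in> \<F>" for X using empty.prems(3) that by auto
  then have "(\<lambda>X. X \<inter> S0) ` \<F> = \<F>" by simp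
  then show ?case by simp
next
  case (insert s D)
  let ?G = "(\<lambda>X. X \<inter> (S0 \<union> D)) ` \<F>"
  have "card \<F> \<le> card ?G + 1"
    by (rule card_trace_insert[of "S0 \<union> D" s _ f]) (use insert.hyps insert.prems in simp_all)
  also have "card ?G \<le> card ((\<lambda>X. X \<inter> S0) ` ?G) + card D"
  proof (rule insert.IH)
    fix X assume "X \<in> ?G"
    then obtain Y where "Y \<in> \<F>" "X = Y \<inter> (S0 \<union> D)" by blast
    moreover have "satisfies f (S0 \<union> insert s D) Y" by (rule insert.prems(4)[OF \<open>Y \<in> \<F>\<close>])
    ultimately show "satisfies f (S0 \<union> D) X" by (simp only:) (rule satisfies_subset, auto)
  qed (use insert.prems(1-3) in auto)
  also have "(\<lambda>X. X \<inter> S0) ` ?G = (\<lambda>X. X \<inter> S0) ` \<F>"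
  proof -
    have "S0 \<inter> (S0 \<union> D) = S0" "(S0 \<union> D) \<inter> S0 = S0" by auto
    then show ?thesis by (simp only: image_image Int_assoc)
  qed
  finally show ?case using insert.hyps by simp
qed

lemma card_satisfying_le:
  assumes "finite S" "\<F> \<subseteq> Pow S" "\<And>X. X \<in> \<F> \<Longrightarrow> satisfies f S X"
  shows "card \<F> \<le> card S + 1"
proof -
  have "card \<F> \<le> card ((\<lambda>X. X \<inter> {}) ` \<F>) + card S"
    by (rule card_trace[of _ _ _ f]) (use assms in auto)
  also have "card ((\<lambda>X. X \<inter> {}) ` \<F>) \<le> card {{}::nat set}" by (rule card_mono) auto
  finally show ?thesis by simp
qed

text \<open>The forbidden patterns on any three rows come from a tree: at most one of the rows (the
  middle one of a path) uses different values against the other two.\<close>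
definition median_condition :: "nat \<Rightarrow> (nat \<Rightarrow> nat \<Rightarrow> bool) \<Rightarrow> bool" where
  "median_condition m f \<longleftrightarrow> (\<forall>i<m. \<forall>j<m. \<forall>k<m. i \<noteq> j \<longrightarrow> i \<noteq> k \<longrightarrow> j \<noteq> k \<longrightarrow>
     f i j = f i k \<or> f j i = f j k)"

text \<open>The value at \<open>i\<close> is the rare one against exactly one of \<open>j\<close>,
  \<open>k\<close> and thereby determines the entry of that row; likewise for \<open>j\<close>. This
  leaves at most three traces on the triple, one fewer than the general bound of four.\<close>

lemma card_satisfying_less:
  assumes "finite S" "\<F> \<subseteq> Pow S" "\<And>X. X \<in> \<F> \<Longrightarrow> satisfies f S X"
    and ijk: "i \<in> S" "j \<in> S" "k \<in> S" "i \<noteq> j" "i \<noteq> k" "j \<noteq> k" "f i j \<noteq> f i k" "f j i \<noteq> f j k"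
  shows "card \<F> \<le> card S"
proof -
  let ?T = "{i, j, k}"
  define mk where "mk a b c = {x. x = i \<and> a \<or> x = j \<and> b \<or> x = k \<and> c}" for a b c
  have c3: "card ?T = 3" using ijk by simp
  have "card \<F> \<le> card ((\<lambda>X. X \<inter> ?T) ` \<F>) + card (S - ?T)"
  proof (rule card_trace[of _ _ _ f])
    have "?T \<union> (S - ?T) = S" using ijk by auto
    then show "\<F> \<subseteq> Pow (?T \<union> (S - ?T))" "\<And>X. X \<in> \<F> \<Longrightarrow> satisfies f (?T \<union> (S - ?T)) X"
      using assms by auto
  qed (use assms in auto)
  also have "(\<lambda>X. X \<inter> ?T) ` \<F> \<subseteq> {mk (f i j) (\<not> f j i) (\<not> f k j), mk (\<not> f i j) (f j i) (\<not> f k i),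
      mk (\<not> f i j) (\<not> f j i) (\<not> f k i)}"
  proof
    fix Y assume "Y \<in> (\<lambda>X. X \<inter> ?T) ` \<F>"
    then obtain X where X: "X \<in> \<F>" "Y = X \<inter> ?T" by blast
    have s: "satisfies f S X" using assms(3) X by blast
    have 1: "\<not> ((i \<in> X) = f i j \<and> (j \<in> X) = f j i)" "\<not> ((i \<in> X) = f i k \<and> (k \<in> X) = f k i)"
      "\<not> ((j \<in> X) = f j k \<and> (k \<in> X) = f k j)"
      using s ijk unfolding satisfies_def by blast+
    have Y: "Y = mk (i \<in> X) (j \<in> X) (k \<in> X)" unfolding X(2) mk_def by auto
    consider "(i \<in> X) = f i j" | "(i \<in> X) = (\<not> f i j)" "(j \<in> X) = f j i"
      | "(i \<in> X) = (\<not> f i j)" "(j \<in> X) = (\<not> f j i)" by blast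
    then show "Y \<in> {mk (f i j) (\<not> f j i) (\<not> f k j), mk (\<not> f i j) (f j i) (\<not> f k i),
      mk (\<not> f i j) (\<not> f j i) (\<not> f k i)}"
    proof cases
      case 1
      have "(j \<in> X) = (\<not> f j i)" using 1 \<open>\<not> ((i \<in> X) = f i j \<and> (j \<in> X) = f j i)\<close> by blast
      moreover have "(k \<in> X) = (\<not> f k j)" using calculation ijk(8) \<open>\<not> ((j \<in> X) = f j k \<and> (k \<in> X) = f k j)\<close> by blast
      ultimately show ?thesis using Y 1 by simp
    next
      case 2
      have "(k \<in> X) = (\<not> f k i)" using 2 ijk(7) \<open>\<not> ((i \<in> X) = f i k \<and> (k \<in> X) = f k i)\<close> by blast
      then show ?thesis using Y 2 by simp
    next
      case 3
      have "(k \<in> X) = (\<not> f k i)" using 3 ijk(7) \<open>\<not> ((i \<in> X) = f i k \<and> (k \<in> X) = f k i)\<close> by blast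
      then show ?thesis using Y 3 by simp
    qed
  qed
  then have "card ((\<lambda>X. X \<inter> ?T) ` \<F>) \<le> card {mk (f i j) (\<not> f j i) (\<not> f k j), mk (\<not> f i j) (f j i) (\<not> f k i),
      mk (\<not> f i j) (\<not> f j i) (\<not> f k i)}" by (intro card_mono) auto
  also have "\<dots> \<le> 3" by (simp add: card_insert_if)
  also have "card (S - ?T) = card S - 3" using ijk assms(1) c3 by (subst card_Diff_subset) auto
  finally have "card \<F> \<le> 3 + (card S - 3)" by simp
  moreover have "3 \<le> card S" using card_mono[of S ?T] ijk assms(1) c3 by simp
  ultimately show ?thesis by simp
qed

section \<open>Columns grouped by their support\<close>

definition violates :: "(nat \<Rightarrow> nat \<Rightarrow> bool) \<Rightarrow> nat list \<Rightarrow> nat \<Rightarrow> nat \<Rightarrow> bool" where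
  "violates f x i j \<longleftrightarrow> x ! i = of_bool (f i j) \<and> x ! j = of_bool (f j i)"

definition satisfying :: "nat \<Rightarrow> (nat \<Rightarrow> nat \<Rightarrow> bool) \<Rightarrow> nat list set \<Rightarrow> nat list set" where
  "satisfying m f C = {x \<in> C. \<forall>i<m. \<forall>j<m. i \<noteq> j \<longrightarrow> \<not> violates f x i j}"

text \<open>A tree with edge set \<open>S\<close> has \<open>card S + 1\<close> vertices; in the
  extremal case each of them is a column with support \<open>S\<close>.\<close>

definition base :: "nat \<Rightarrow> nat" where
  "base m = (\<Sum>S\<in>Pow {..<m}. card S + 1)"

definition support :: "nat \<Rightarrow> nat list \<Rightarrow> nat set" where
  "support m x = {i. i < m \<and> x ! i \<noteq> 2}"

lemma columns_nth: "x \<in> columns m \<Longrightarrow> i < m \<Longrightarrow> x ! i = 0 \<or> x ! i = 1 \<or> x ! i = 2"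
proof -
  assume "x \<in> columns m" "i < m"
  then have "x ! i \<in> {..<3}" unfolding columns_def using nth_mem by blast
  then show ?thesis by auto
qed

lemma columns_eqI:
  assumes "x \<in> columns m" "y \<in> columns m" "\<And>i. i < m \<Longrightarrow> x ! i = y ! i"
  shows "x = y"
  using assms unfolding columns_def by (intro nth_equalityI) auto

text \<open>The columns of a fixed support \<open>S\<close> are subsets of \<open>S\<close>, namely the sets of their 1-entries.\<close>
lemma card_satisfying_support:
  assumes "C \<subseteq> columns m" "S \<subseteq> {..<m}"
  obtains \<F> where "\<F> \<subseteq> Pow S" "card \<F> = card {x \<in> satisfying m f C. support m x = S}"
    "\<And>X. X \<in> \<F> \<Longrightarrow> satisfies f S X"
proof -
  let ?G = "{x \<in> satisfying m f C. support m x = S}"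
  let ?o = "\<lambda>x. {i \<in> S. x ! i = 1}"
  have GC: "x \<in> columns m" if "x \<in> ?G" for x using that assms(1) unfolding satisfying_def by auto
  have nth: "x ! i = (if i \<in> S then of_bool (i \<in> ?o x) else 2)" if "x \<in> ?G" "i < m" for x i
    using columns_nth[OF GC[OF that(1)] that(2)] that unfolding support_def by auto
  have inj: "inj_on ?o ?G"
  proof (rule inj_onI)
    fix x y assume h: "x \<in> ?G" "y \<in> ?G" "?o x = ?o y"
    show "x = y"
    proof (rule columns_eqI[OF GC[OF h(1)] GC[OF h(2)]])
      fix i assume "i < m"
      then show "x ! i = y ! i" using nth[OF h(1)] nth[OF h(2)] h(3) by (simp only:)
    qed
  qed
  show thesis
  proof (rule that[of "?o ` ?G"])
    show "?o ` ?G \<subseteq> Pow S" by auto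
    show "card (?o ` ?G) = card ?G" using inj by (rule card_image)
    fix X assume "X \<in> ?o ` ?G"
    then obtain x where x: "x \<in> ?G" "X = ?o x" by blast
    show "satisfies f S X" unfolding satisfies_def
    proof (intro ballI impI notI)
      fix i j assume ij: "i \<in> S" "j \<in> S" "i \<noteq> j" "(i \<in> X) = f i j \<and> (j \<in> X) = f j i"
      have "i < m" "j < m" using ij assms(2) by auto
      then have "x ! i = of_bool (f i j)" "x ! j = of_bool (f j i)"
        using nth[OF x(1), of i] nth[OF x(1), of j] ij x(2) by auto
      then show False using x(1) \<open>i < m\<close> \<open>j < m\<close> ij(3) unfolding satisfying_def violates_def by blast
    qed
  qed
qed

lemma card_by_support:
  assumes "C \<subseteq> columns m"
  shows "card C = (\<Sum>S\<in>Pow {..<m}. card {x \<in> C. support m x = S})"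
proof -
  have "finite C" using assms finite_columns finite_subset by blast
  moreover have "support m ` C \<subseteq> Pow {..<m}" unfolding support_def by auto
  ultimately have "(\<Sum>S\<in>Pow {..<m}. \<Sum>x | x \<in> C \<and> support m x = S. 1) = (\<Sum>x\<in>C. 1::nat)"
    by (intro sum.group) auto
  then show ?thesis by simp
qed

lemma satisfying_subset: "satisfying m f C \<subseteq> C"
  unfolding satisfying_def by blast

lemma card_satisfying_base:
  assumes "C \<subseteq> columns m"
  shows "card (satisfying m f C) \<le> base m"
proof -
  have "card (satisfying m f C) = (\<Sum>S\<in>Pow {..<m}. card {x \<in> satisfying m f C. support m x = S})"
    by (rule card_by_support) (use assms satisfying_subset in blast)
  also have "\<dots> \<le> base m" unfolding base_def
  proof (rule sum_mono)
    fix S assume "S \<in> Pow {..<m}"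
    then have S: "S \<subseteq> {..<m}" "finite S" using finite_subset by auto
    obtain \<F> where "\<F> \<subseteq> Pow S" "card \<F> = card {x \<in> satisfying m f C. support m x = S}"
      "\<And>X. X \<in> \<F> \<Longrightarrow> satisfies f S X"
      using card_satisfying_support[OF assms S(1), of f thesis] by simp
    then show "card {x \<in> satisfying m f C. support m x = S} \<le> card S + 1"
      using card_satisfying_le[OF S(2), of \<F> f] by simp
  qed
  finally show ?thesis .
qed

lemma card_supersets:
  assumes "T \<subseteq> {..<m}" "card T = 3"
  shows "card {S. S \<subseteq> {..<m} \<and> T \<subseteq> S} = 2 ^ (m - 3)"
proof -
  have "{S. S \<subseteq> {..<m} \<and> T \<subseteq> S} = (\<lambda>U. T \<union> U) ` Pow ({..<m} - T)"
  proof (intro subset_antisym subsetI)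
    fix S assume "S \<in> {S. S \<subseteq> {..<m} \<and> T \<subseteq> S}"
    then show "S \<in> (\<lambda>U. T \<union> U) ` Pow ({..<m} - T)" by (intro image_eqI[of _ _ "S - T"]) auto
  qed (use assms in auto)
  moreover have "inj_on (\<lambda>U. T \<union> U) (Pow ({..<m} - T))" by (rule inj_onI) blast
  moreover have "card ({..<m} - T) = m - 3" using assms finite_subset by (subst card_Diff_subset) auto
  ultimately show ?thesis by (simp add: card_image card_Pow)
qed

text \<open>Three rows that refute the median condition cost one column in every support containing
  them.\<close>

lemma card_satisfying_deficit:
  assumes "C \<subseteq> columns m" "\<not> median_condition m f"
  shows "card (satisfying m f C) + 2 ^ (m - 3) \<le> base m"
proof -
  obtain i j k where ijk: "i < m" "j < m" "k < m" "i \<noteq> j" "i \<noteq> k" "j \<noteq> k" "f i j \<noteq> f i k" "f j i \<noteq> f j k"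
    using assms(2) unfolding median_condition_def by auto
  let ?T = "{i, j, k}"
  have "card (satisfying m f C) = (\<Sum>S\<in>Pow {..<m}. card {x \<in> satisfying m f C. support m x = S})"
    by (rule card_by_support) (use assms satisfying_subset in blast)
  moreover have "(2::nat) ^ (m - 3) = card {S. S \<subseteq> {..<m} \<and> ?T \<subseteq> S}"
    by (subst card_supersets) (use ijk in auto)
  moreover have "{S. S \<subseteq> {..<m} \<and> ?T \<subseteq> S} = {S \<in> Pow {..<m}. ?T \<subseteq> S}" by blast
  moreover have "card {S \<in> Pow {..<m}. ?T \<subseteq> S} = (\<Sum>S\<in>Pow {..<m}. if ?T \<subseteq> S then 1 else 0)"
    by (simp only: card_eq_sum, rule sum.inter_filter) simp
  ultimately have "card (satisfying m f C) + 2 ^ (m - 3) =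
     (\<Sum>S\<in>Pow {..<m}. card {x \<in> satisfying m f C. support m x = S} + (if ?T \<subseteq> S then 1 else 0))"
    by (simp only: sum.distrib)
  also have "\<dots> \<le> base m" unfolding base_def
  proof (rule sum_mono)
    fix S assume "S \<in> Pow {..<m}"
    then have S: "S \<subseteq> {..<m}" "finite S" using finite_subset by auto
    obtain \<F> where F: "\<F> \<subseteq> Pow S" "card \<F> = card {x \<in> satisfying m f C. support m x = S}"
      "\<And>X. X \<in> \<F> \<Longrightarrow> satisfies f S X"
      using card_satisfying_support[OF assms(1) S(1), of f thesis] by simp
    show "card {x \<in> satisfying m f C. support m x = S} + (if ?T \<subseteq> S then 1 else 0) \<le> card S + 1"
    proof (cases "?T \<subseteq> S")
      case True
      have "card \<F> \<le> card S"
        by (rule card_satisfying_less[OF S(2) F(1), of f i j k]) (use F(3) True ijk in auto)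
      then show ?thesis using F(2) True by simp
    next
      case False
      have "card \<F> \<le> card S + 1" by (rule card_satisfying_le[OF S(2) F(1), of f]) (use F(3) in auto)
      then show ?thesis using F(2) by (simp only: False if_False)
    qed
  qed
  finally show ?thesis .
qed

subsection \<open>Incomparable pairs and extremal elements of a poset\<close>

definition strict_order_on :: "'a set \<Rightarrow> ('a \<Rightarrow> 'a \<Rightarrow> bool) \<Rightarrow> bool" where
  "strict_order_on M lt \<longleftrightarrow> (\<forall>x\<in>M. \<not> lt x x) \<and> (\<forall>x\<in>M. \<forall>y\<in>M. \<forall>z\<in>M. lt x y \<longrightarrow> lt y z \<longrightarrow> lt x z)"

definition incomparable :: "('a \<Rightarrow> 'a \<Rightarrow> bool) \<Rightarrow> 'a \<Rightarrow> 'a \<Rightarrow> bool" where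
  "incomparable lt i k \<longleftrightarrow> i \<noteq> k \<and> \<not> lt i k \<and> \<not> lt k i"

definition incomparable_edges :: "('a \<Rightarrow> 'a \<Rightarrow> bool) \<Rightarrow> 'a set \<Rightarrow> 'a set \<Rightarrow> 'a set set" where
  "incomparable_edges lt X M = {{i, k} | i k. i \<in> X \<and> k \<in> M \<and> incomparable lt i k}"

definition not_above :: "('a \<Rightarrow> 'a \<Rightarrow> bool) \<Rightarrow> 'a set \<Rightarrow> 'a \<Rightarrow> nat" where
  "not_above lt M i = card {k \<in> M. k \<noteq> i \<and> \<not> lt i k}"

lemma strict_order_onD:
  assumes "strict_order_on M lt"
  shows "x \<in> M \<Longrightarrow> \<not> lt x x" "x \<in> M \<Longrightarrow> y \<in> M \<Longrightarrow> z \<in> M \<Longrightarrow> lt x y \<Longrightarrow> lt y z \<Longrightarrow> lt x z"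
    "x \<in> M \<Longrightarrow> y \<in> M \<Longrightarrow> lt x y \<Longrightarrow> \<not> lt y x"
proof -
  show 1: "x \<in> M \<Longrightarrow> \<not> lt x x" for x using assms unfolding strict_order_on_def by blast
  show 2: "x \<in> M \<Longrightarrow> y \<in> M \<Longrightarrow> z \<in> M \<Longrightarrow> lt x y \<Longrightarrow> lt y z \<Longrightarrow> lt x z" for x y z
    using assms unfolding strict_order_on_def by blast
  show "x \<in> M \<Longrightarrow> y \<in> M \<Longrightarrow> lt x y \<Longrightarrow> \<not> lt y x" using 1[of x] 2[of x y x] by blast
qed

lemma strict_order_on_converse: "strict_order_on M lt \<Longrightarrow> strict_order_on M (\<lambda>x y. lt y x)"
  unfolding strict_order_on_def by blast

lemma strict_order_ex_minimal:
  assumes "strict_order_on M lt" "finite A" "A \<noteq> {}" "A \<subseteq> M"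
  obtains x where "x \<in> A" "\<And>y. y \<in> A \<Longrightarrow> \<not> lt y x"
proof -
  have "asymp_on A lt" using strict_order_onD(3)[OF assms(1)] assms(4) by (intro asymp_onI) blast
  moreover have "transp_on A lt" using strict_order_onD(2)[OF assms(1)] assms(4) by (intro transp_onI) blast
  ultimately obtain x where x: "x \<in> A" "\<forall>y\<in>A. y \<noteq> x \<longrightarrow> \<not> lt y x"
    using Finite_Set.bex_min_element[of A lt] assms(2,3) by blast
  have "\<not> lt x x" using strict_order_onD(1)[OF assms(1)] x(1) assms(4) by blast
  then have "\<not> lt y x" if "y \<in> A" for y using x(2) that by (cases "y = x") auto
  then show thesis by (rule that[OF x(1)])
qed

text \<open>Minimal elements are added one by one. When \<open>x\<close> joins a down-set of size
  \<open>a\<close>, the elements not above \<open>x\<close> are all \<open>a\<close> earlier ones,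
  since none of these can be above \<open>x\<close>, and the later ones incomparable to
  \<open>x\<close>. The former sum to \<open>a choose 2\<close>, the latter are new incomparable
  edges. The up-set \<open>Z\<close> keeps a second such set, built in the converse order, disjoint
  from the first.\<close>

lemma ex_down_set:
  assumes "finite M" and ord: "strict_order_on M lt" and "Z \<subseteq> M"
    and up: "\<forall>z\<in>Z. \<forall>x\<in>M. lt z x \<longrightarrow> x \<in> Z" and "a \<le> card (M - Z)"
  shows "\<exists>X\<subseteq>M - Z. card X = a \<and> (\<forall>x\<in>X. \<forall>y\<in>M. lt y x \<longrightarrow> y \<in> X) \<and>
     (\<Sum>i\<in>X. not_above lt M i) = (a choose 2) + card (incomparable_edges lt X M)"
  using assms(5)
proof (induction a)
  case 0
  have "(0::nat) choose 2 = 0" by (simp add: numeral_2_eq_2)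
  then show ?case by (intro exI[of _ "{}"]) (auto simp: incomparable_edges_def)
next
  case (Suc a)
  then obtain X where X: "X \<subseteq> M - Z" "card X = a" "\<forall>x\<in>X. \<forall>y\<in>M. lt y x \<longrightarrow> y \<in> X"
     "(\<Sum>i\<in>X. not_above lt M i) = (a choose 2) + card (incomparable_edges lt X M)" by auto
  have fX: "finite X" using X(1) assms(1) finite_subset by blast
  have "M - Z - X \<noteq> {}"
  proof
    assume "M - Z - X = {}"
    then have "M - Z = X" using X(1) by blast
    then show False using X(2) Suc.prems by simp
  qed
  then obtain x where x: "x \<in> M - Z - X" "\<And>y. y \<in> M - Z - X \<Longrightarrow> \<not> lt y x"
    using strict_order_ex_minimal[OF ord, of "M - Z - X" thesis] assms(1) by auto
  have below: "y \<in> X" if "y \<in> M" "lt y x" for y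
    using x(1) x(2)[of y] up that by blast
  define K where "K = {k \<in> M - X - {x}. incomparable lt x k}"
  have fK: "finite K" unfolding K_def using assms(1) by simp
  have xM: "x \<in> M" "x \<notin> X" using x(1) by auto
  have "\<not> lt x k" if "k \<in> X" for k using that X(3) xM by blast
  then have "{k \<in> M. k \<noteq> x \<and> \<not> lt x k} = X \<union> K"
    using below X(1) xM unfolding K_def incomparable_def by auto
  moreover have "X \<inter> K = {}" unfolding K_def by auto
  ultimately have na: "not_above lt M x = a + card K"
    unfolding not_above_def using card_Un_disjoint[OF fX fK] X(2) by simp
  have sym: "incomparable lt i k = incomparable lt k i" for i k unfolding incomparable_def by auto
  have E: "incomparable_edges lt (insert x X) M = incomparable_edges lt X M \<union> (\<lambda>k. {x, k}) ` K" (is "?L = ?A \<union> ?B")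
  proof (intro subset_antisym subsetI)
    fix s assume "s \<in> ?L"
    then obtain i k where ik: "s = {i, k}" "i \<in> insert x X" "k \<in> M" "incomparable lt i k"
      unfolding incomparable_edges_def by blast
    show "s \<in> ?A \<union> ?B"
    proof (cases "i \<in> X")
      case True
      then show ?thesis using ik unfolding incomparable_edges_def by blast
    next
      case False
      then have i: "i = x" using ik by blast
      show ?thesis
      proof (cases "k \<in> X")
        case True
        then have "s = {k, x}" "incomparable lt k x" using ik i sym by auto
        then show ?thesis using True xM unfolding incomparable_edges_def by blast
      next
        case False
        then have "k \<in> K" using ik i unfolding K_def incomparable_def by auto
        then show ?thesis using ik(1) i by blast
      qed
    qed
  next
    fix s assume "s \<in> ?A \<union> ?B"
    then show "s \<in> ?L" unfolding incomparable_edges_def K_def by blast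
  qed
  have fA: "finite ?A" by (rule finite_subset[of _ "Pow M"]) (use X(1) assms(1) in \<open>auto simp: incomparable_edges_def\<close>)
  have "?A \<inter> ?B = {}"
  proof (rule ccontr)
    assume "?A \<inter> ?B \<noteq> {}"
    then obtain i k l where "i \<in> X" "{i, k} = {x, l}" "l \<in> K" unfolding incomparable_edges_def by blast
    then show False using xM unfolding K_def by (auto simp: doubleton_eq_iff)
  qed
  then have "card (incomparable_edges lt (insert x X) M) = card ?A + card ?B"
    unfolding E using fA fK by (intro card_Un_disjoint) auto
  also have "card ?B = card K" by (rule card_image) (auto simp: inj_on_def doubleton_eq_iff)
  finally have cE: "card (incomparable_edges lt (insert x X) M) = card ?A + card K" .
  have "Suc a choose 2 = a + (a choose 2)" by (simp add: numeral_2_eq_2)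
  then have "(\<Sum>i\<in>insert x X. not_above lt M i) = (Suc a choose 2) + card (incomparable_edges lt (insert x X) M)"
    using X(4) na cE fX xM by simp
  moreover have "card (insert x X) = Suc a" using fX xM X(2) by simp
  moreover have "\<forall>z\<in>insert x X. \<forall>y\<in>M. lt y z \<longrightarrow> y \<in> insert x X" using X(3) below by blast
  ultimately show ?case using X(1) x(1) by (intro exI[of _ "insert x X"]) auto
qed

text \<open>A maximal element \<open>i\<close> of the level set for \<open>v\<close> has all others
  of that set among the elements not above it, so the level set has at most
  \<open>not_above lt M i + 1 \<le> card X - v\<close> elements.\<close>

lemma capped_not_above:
  assumes "finite M" and ord: "strict_order_on M lt" and "X \<subseteq> M"
  shows "capped X (\<lambda>i. int (card X) - 1 - int (not_above lt M i))"
  unfolding capped_def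
proof (intro allI impI)
  fix v :: int
  let ?Z = "{i \<in> X. v \<le> int (card X) - 1 - int (not_above lt M i)}"
  have fX: "finite X" using assms finite_subset by blast
  show "int (card ?Z) \<le> max 0 (int (card X) - v)"
  proof (cases "?Z = {}")
    case True
    show ?thesis unfolding True by simp
  next
    case False
    have "?Z \<subseteq> M" "finite ?Z" using assms(3) fX by auto
    then obtain i where i: "i \<in> ?Z" "\<And>y. y \<in> ?Z \<Longrightarrow> \<not> lt i y"
      using strict_order_ex_minimal[OF strict_order_on_converse[OF ord], of ?Z thesis] False by simp
    have "?Z - {i} \<subseteq> {k \<in> M. k \<noteq> i \<and> \<not> lt i k}" using i(2) assms(3) by blast
    then have "card (?Z - {i}) \<le> not_above lt M i"
      unfolding not_above_def using assms(1) by (intro card_mono) auto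
    moreover have "Suc (card (?Z - {i})) = card ?Z" using i(1) fX by (intro card_Suc_Diff1) auto
    ultimately have "int (card ?Z) \<le> int (not_above lt M i) + 1" by linarith
    moreover have "v \<le> int (card X) - 1 - int (not_above lt M i)" using i(1) by simp
    ultimately show ?thesis by linarith
  qed
qed

text \<open>The sets \<open>X\<close> and \<open>Y\<close> are a down-set and an up-set; an incomparable pair across them
  forces every element outside \<open>X \<union> Y\<close> into a further incomparable pair.\<close>
lemma many_incomparable_or_extremal_sets:
  fixes lt :: "'a \<Rightarrow> 'a \<Rightarrow> bool"
  assumes "finite M" and ord: "strict_order_on M lt" and ab: "a + b \<le> card M"
  shows "card M + 1 \<le> card (incomparable_edges lt M M) + a + b \<or>
    (\<exists>X\<subseteq>M. \<exists>Y\<subseteq>M. \<exists>\<alpha> \<beta>. card X = a \<and> card Y = b \<and> capped X \<alpha> \<and> capped Y \<beta> \<and>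
       int ((a choose 2) + (b choose 2)) \<le> sum \<alpha> X + sum \<beta> Y + int (card (incomparable_edges lt M M)) \<and>
       (\<forall>i\<in>X. \<forall>j\<in>Y. lt i j \<and>
          int (card {k \<in> M. k \<noteq> i \<and> k \<noteq> j \<and> \<not> (lt i k \<and> lt k j)}) + \<alpha> i + \<beta> j \<le> int a + int b - 2))"
proof -
  let ?gt = "\<lambda>x y. lt y x"
  let ?E = "incomparable_edges lt M M"
  have ord': "strict_order_on M ?gt" by (rule strict_order_on_converse[OF ord])
  have fE: "finite ?E" by (rule finite_subset[of _ "Pow M"]) (use assms(1) in \<open>auto simp: incomparable_edges_def\<close>)
  obtain X where X: "X \<subseteq> M" "card X = a" "\<forall>x\<in>X. \<forall>y\<in>M. lt y x \<longrightarrow> y \<in> X"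
     "(\<Sum>i\<in>X. not_above lt M i) = (a choose 2) + card (incomparable_edges lt X M)"
    using ex_down_set[OF assms(1) ord, of "{}" a] ab by auto
  have fX: "finite X" using X(1) assms(1) finite_subset by blast
  have "b \<le> card (M - X)" using X(1,2) ab fX by (simp add: card_Diff_subset)
  then obtain Y where Y: "Y \<subseteq> M - X" "card Y = b" "\<forall>x\<in>Y. \<forall>y\<in>M. lt x y \<longrightarrow> y \<in> Y"
     "(\<Sum>i\<in>Y. not_above ?gt M i) = (b choose 2) + card (incomparable_edges ?gt Y M)"
    using ex_down_set[OF assms(1) ord', of X b] X by auto
  have fY: "finite Y" using Y(1) assms(1) finite_subset by blast
  have gE: "incomparable_edges ?gt Y M = incomparable_edges lt Y M"
    unfolding incomparable_edges_def incomparable_def by blast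
  show ?thesis
  proof (cases "\<exists>i\<in>X. \<exists>j\<in>Y. incomparable lt i j")
    case True
    then obtain i j where ij: "i \<in> X" "j \<in> Y" "incomparable lt i j" by blast
    have ijM: "i \<in> M" "j \<in> M" using ij X(1) Y(1) by auto
    let ?R = "M - X - Y"
    \<comment> \<open>A row \<open>k\<close> of \<open>?R\<close> comparable to both would satisfy
      \<open>lt i k\<close> and \<open>lt k j\<close>, hence \<open>lt i j\<close>. The edges
      \<open>g k\<close> and \<open>{i, j}\<close> are distinct, which gives
      \<open>card M - a - b + 1\<close> of them.\<close>
    define g where "g k = (if incomparable lt i k then {i, k} else {j, k})" for k
    have sym: "incomparable lt x k = incomparable lt k x" for x k unfolding incomparable_def by auto
    have "incomparable lt i k \<or> incomparable lt j k" if k: "k \<in> ?R" for k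
    proof (rule ccontr)
      assume h: "\<not> ?thesis"
      have "i \<noteq> k" "j \<noteq> k" using k ij by auto
      then have "lt i k \<or> lt k i" "lt j k \<or> lt k j" using h unfolding incomparable_def by auto
      moreover have "\<not> lt k i" "\<not> lt j k" using X(3) Y(3) ij k by auto
      ultimately have "lt i k" "lt k j" by auto
      then have "lt i j" using strict_order_onD(2)[OF ord, of i k j] ijM k by blast
      then show False using ij(3) unfolding incomparable_def by blast
    qed
    then have gE: "g ` ?R \<subseteq> ?E" unfolding g_def incomparable_edges_def using ijM by auto
    have inj: "inj_on g ?R"
    proof (rule inj_onI)
      fix k l assume "k \<in> ?R" "l \<in> ?R" "g k = g l"
      moreover have "k \<notin> {i, j}" "l \<notin> {i, j}" using calculation ij by auto
      ultimately show "k = l" unfolding g_def by (auto simp: doubleton_eq_iff split: if_splits)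
    qed
    have "{i, j} \<notin> g ` ?R"
    proof
      assume "{i, j} \<in> g ` ?R"
      then obtain k where "k \<in> ?R" "{i, j} = g k" by blast
      moreover have "k \<in> g k" unfolding g_def by auto
      ultimately show False using ij by auto
    qed
    then have "card (insert {i, j} (g ` ?R)) = Suc (card ?R)"
      using inj assms(1) by (simp add: card_image)
    moreover have "insert {i, j} (g ` ?R) \<subseteq> ?E" using gE ij ijM unfolding incomparable_edges_def by auto
    ultimately have "Suc (card ?R) \<le> card ?E" using card_mono[OF fE] by metis
    moreover have "card ?R = card M - a - b" using X(1,2) Y(1,2) fX fY by (simp add: card_Diff_subset)
    ultimately show ?thesis using ab by linarith
  next
    case False
    \<comment> \<open>In these terms the sum over \<open>X\<close> is \<open>a choose 2\<close>
      minus the number of incomparable edges meeting \<open>X\<close>: either incomparable pairs are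
      many, or the values are large and pairs across have few rows outside.\<close>
    define \<alpha> where "\<alpha> i = int (card X) - 1 - int (not_above lt M i)" for i
    define \<beta> where "\<beta> i = int (card Y) - 1 - int (not_above ?gt M i)" for i
    have cross: "lt i j" if "i \<in> X" "j \<in> Y" for i j
    proof -
      have "i \<noteq> j" "\<not> lt j i" using that X(3) Y(1) by auto
      then show ?thesis using False that unfolding incomparable_def by blast
    qed
    have capX: "capped X \<alpha>" unfolding \<alpha>_def by (rule capped_not_above[OF assms(1) ord X(1)])
    have capY: "capped Y \<beta>" unfolding \<beta>_def by (rule capped_not_above[OF assms(1) ord']) (use Y(1) in auto)
    let ?EX = "incomparable_edges lt X M" and ?EY = "incomparable_edges lt Y M"
    have "?EX \<subseteq> ?E" "?EY \<subseteq> ?E" using X(1) Y(1) unfolding incomparable_edges_def by blast+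
    moreover have "?EX \<inter> ?EY = {}"
    proof (rule ccontr)
      assume "?EX \<inter> ?EY \<noteq> {}"
      then obtain s where "s \<in> ?EX" "s \<in> ?EY" by blast
      then obtain i k j l where h: "i \<in> X" "j \<in> Y" "{i, k} = {j, l}" "incomparable lt i k"
        unfolding incomparable_edges_def by auto
      have "i \<noteq> j" using h Y(1) by auto
      then have "k = j" using h(3) by (auto simp: doubleton_eq_iff)
      then show False using False h by blast
    qed
    ultimately have EE: "card ?EX + card ?EY \<le> card ?E"
      using fE by (metis card_Un_disjoint card_mono finite_subset Un_least)
    have choose: "int (n * (n - 1)) = 2 * int (n choose 2)" for n
    proof -
      have "n * (n - 1) = 2 * (n choose 2)" unfolding choose_two by (cases n) auto
      then show ?thesis by simp
    qed
    have sX: "sum \<alpha> X = int (a choose 2) - int (card ?EX)"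
    proof -
      have "sum \<alpha> X = int a * (int a - 1) - int (\<Sum>i\<in>X. not_above lt M i)"
        unfolding \<alpha>_def using X(2) by (simp add: sum_subtractf sum.distrib algebra_simps)
      also have "int a * (int a - 1) = int (a * (a - 1))" by (cases a) (auto simp: algebra_simps)
      finally show ?thesis using X(4) choose[of a] by simp
    qed
    have sY: "sum \<beta> Y = int (b choose 2) - int (card ?EY)"
    proof -
      have "sum \<beta> Y = int b * (int b - 1) - int (\<Sum>i\<in>Y. not_above ?gt M i)"
        unfolding \<beta>_def using Y(2) by (simp add: sum_subtractf sum.distrib algebra_simps)
      also have "int b * (int b - 1) = int (b * (b - 1))" by (cases b) (auto simp: algebra_simps)
      finally show ?thesis using Y(4) choose[of b] unfolding gE by simp
    qed
    have out: "lt i j \<and> int (card {k \<in> M. k \<noteq> i \<and> k \<noteq> j \<and> \<not> (lt i k \<and> lt k j)}) + \<alpha> i + \<beta> j \<le> int a + int b - 2"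
      if ij: "i \<in> X" "j \<in> Y" for i j
    proof -
      have "{k \<in> M. k \<noteq> i \<and> k \<noteq> j \<and> \<not> (lt i k \<and> lt k j)} \<subseteq> {k \<in> M. k \<noteq> i \<and> \<not> lt i k} \<union> {k \<in> M. k \<noteq> j \<and> \<not> lt k j}"
        by blast
      then have "card {k \<in> M. k \<noteq> i \<and> k \<noteq> j \<and> \<not> (lt i k \<and> lt k j)} \<le> card ({k \<in> M. k \<noteq> i \<and> \<not> lt i k} \<union> {k \<in> M. k \<noteq> j \<and> \<not> lt k j})"
        using assms(1) by (intro card_mono) auto
      also have "\<dots> \<le> not_above lt M i + not_above ?gt M j" unfolding not_above_def by (rule card_Un_le)
      finally show ?thesis using cross[OF ij] X(2) Y(2) unfolding \<alpha>_def \<beta>_def by simp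
    qed
    have "int ((a choose 2) + (b choose 2)) \<le> sum \<alpha> X + sum \<beta> Y + int (card ?E)" using sX sY EE by simp
    moreover have "Y \<subseteq> M" using Y(1) by blast
    ultimately have "\<exists>X\<subseteq>M. \<exists>Y\<subseteq>M. \<exists>\<alpha> \<beta>. card X = a \<and> card Y = b \<and> capped X \<alpha> \<and> capped Y \<beta> \<and>
       int ((a choose 2) + (b choose 2)) \<le> sum \<alpha> X + sum \<beta> Y + int (card ?E) \<and>
       (\<forall>i\<in>X. \<forall>j\<in>Y. lt i j \<and>
          int (card {k \<in> M. k \<noteq> i \<and> k \<noteq> j \<and> \<not> (lt i k \<and> lt k j)}) + \<alpha> i + \<beta> j \<le> int a + int b - 2)"
      using X(1,2) Y(2) capX capY out by (intro exI[of _ X] conjI exI[of _ Y] exI[of _ \<alpha>] exI[of _ \<beta>]) auto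
    then show ?thesis ..
  qed
qed

subsection \<open>The upper bound\<close>

definition aligned :: "(nat \<Rightarrow> nat \<Rightarrow> bool) \<Rightarrow> nat \<Rightarrow> nat \<Rightarrow> bool" where
  "aligned f i j \<longleftrightarrow> f i j \<and> \<not> f j i"

text \<open>One representative for each pair of rows; aligned pairs are listed in the direction of
  the order \<open>aligned f\<close>.\<close>
definition row_pairs :: "nat \<Rightarrow> (nat \<Rightarrow> nat \<Rightarrow> bool) \<Rightarrow> (nat \<times> nat) set" where
  "row_pairs m f = {(i, j). i < m \<and> j < m \<and> i \<noteq> j \<and> (aligned f i j \<or> i < j \<and> f i j = f j i)}"

definition unaligned_pairs :: "nat \<Rightarrow> (nat \<Rightarrow> nat \<Rightarrow> bool) \<Rightarrow> (nat \<times> nat) set" where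
  "unaligned_pairs m f = {(i, j). j < m \<and> i < j \<and> f i j = f j i}"

definition violators :: "(nat \<Rightarrow> nat \<Rightarrow> bool) \<Rightarrow> nat list set \<Rightarrow> nat \<times> nat \<Rightarrow> nat list set" where
  "violators f C u = {x \<in> C. violates f x (fst u) (snd u)}"

definition single_violators :: "nat \<Rightarrow> (nat \<Rightarrow> nat \<Rightarrow> bool) \<Rightarrow> nat list set \<Rightarrow> nat \<times> nat \<Rightarrow> nat list set" where
  "single_violators m f C u = {x \<in> violators f C u. \<forall>v\<in>row_pairs m f. x \<in> violators f C v \<longrightarrow> v = u}"

lemma violates_sym: "violates f x i j = violates f x j i"
  unfolding violates_def by auto

lemma row_pairs_cases:
  assumes "i < m" "j < m" "i \<noteq> j"
  shows "(i, j) \<in> row_pairs m f \<or> (j, i) \<in> row_pairs m f"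
  using assms unfolding row_pairs_def aligned_def by (cases "i < j") auto

lemma row_pairs_asym: "(i, j) \<in> row_pairs m f \<Longrightarrow> (j, i) \<notin> row_pairs m f"
  unfolding row_pairs_def aligned_def by auto

lemma finite_row_pairs: "finite (row_pairs m f)"
  by (rule finite_subset[of _ "{..<m} \<times> {..<m}"]) (auto simp: row_pairs_def)

lemma inj_on_row_pairs: "inj_on (\<lambda>(i, j). {i, j}) (row_pairs m f)"
  using row_pairs_asym by (auto simp: inj_on_def doubleton_eq_iff)

lemma card_row_pairs: "card (row_pairs m f) = m choose 2"
proof -
  have "(\<lambda>(i, j). {i, j}) ` row_pairs m f = {B. B \<subseteq> {..<m} \<and> card B = 2}" (is "?L = ?R")
  proof (intro subset_antisym subsetI)
    fix B assume "B \<in> ?L"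
    then show "B \<in> ?R" unfolding row_pairs_def by auto
  next
    fix B assume "B \<in> ?R"
    then obtain i j where ij: "B = {i, j}" "i \<noteq> j" "i < m" "j < m" by (auto simp: card_2_iff)
    then have "(i, j) \<in> row_pairs m f \<or> (j, i) \<in> row_pairs m f" by (intro row_pairs_cases)
    moreover have "B = {j, i}" using ij by auto
    ultimately show "B \<in> ?L" using ij(1) by (auto intro: image_eqI[of _ _ "(i, j)"] image_eqI[of _ _ "(j, i)"])
  qed
  then have "card (row_pairs m f) = card {B. B \<subseteq> {..<m} \<and> card B = 2}"
    using card_image[OF inj_on_row_pairs, of m f] by simp
  then show ?thesis by (simp add: n_subsets)
qed

lemma unaligned_pairs_subset: "unaligned_pairs m f \<subseteq> row_pairs m f"
  unfolding unaligned_pairs_def row_pairs_def by auto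

lemma incomparable_aligned_iff: "incomparable (aligned f) i j \<longleftrightarrow> i \<noteq> j \<and> f i j = f j i"
  unfolding incomparable_def aligned_def by auto

lemma card_unaligned_pairs:
  "card (incomparable_edges (aligned f) {..<m} {..<m}) = card (unaligned_pairs m f)"
proof -
  have "incomparable_edges (aligned f) {..<m} {..<m} = (\<lambda>(i, j). {i, j}) ` unaligned_pairs m f" (is "?L = ?R")
  proof (intro subset_antisym subsetI)
    fix s assume "s \<in> ?L"
    then obtain i j where ij: "s = {i, j}" "i < m" "j < m" "i \<noteq> j" "f i j = f j i"
      unfolding incomparable_edges_def incomparable_aligned_iff by auto
    have "(if i < j then (i, j) else (j, i)) \<in> unaligned_pairs m f"
      using ij unfolding unaligned_pairs_def by auto
    moreover have "s = (\<lambda>(i, j). {i, j}) (if i < j then (i, j) else (j, i))" using ij(1) by auto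
    ultimately show "s \<in> ?R" by (rule rev_image_eqI)
  next
    fix s assume "s \<in> ?R"
    then show "s \<in> ?L" unfolding incomparable_edges_def incomparable_aligned_iff unaligned_pairs_def by fastforce
  qed
  moreover have "inj_on (\<lambda>(i, j). {i, j}) (unaligned_pairs m f)"
    by (rule inj_on_subset[OF inj_on_row_pairs unaligned_pairs_subset])
  ultimately show ?thesis by (simp add: card_image)
qed

text \<open>A column outside \<open>satisfying m f C\<close> that violates only one pair is counted in both summands for
  that pair, any other one for at least two pairs.\<close>
lemma twice_card_le:
  assumes "finite C"
  shows "2 * card C \<le> 2 * card (satisfying m f C) +
     (\<Sum>u\<in>row_pairs m f. card (violators f C u) + card (single_violators m f C u))"
proof -
  let ?B = "C - satisfying m f C" and ?R = "row_pairs m f"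
  let ?h = "\<lambda>x u. (if x \<in> violators f C u then 1 else 0) + (if x \<in> single_violators m f C u then 1 else (0::nat))"
  have two: "2 \<le> (\<Sum>u\<in>?R. ?h x u)" if x: "x \<in> ?B" for x
  proof -
    obtain i j where ij: "i < m" "j < m" "i \<noteq> j" "violates f x i j"
      using x unfolding satisfying_def by auto
    obtain u where u: "u \<in> ?R" "x \<in> violators f C u"
      using row_pairs_cases[OF ij(1-3), of f] ij(4) violates_sym[of f x i j] x unfolding violators_def by auto
    show ?thesis
    proof (cases "x \<in> single_violators m f C u")
      case True
      have "2 \<le> ?h x u" using u True by simp
      also have "\<dots> \<le> (\<Sum>u\<in>?R. ?h x u)" by (rule member_le_sum) (use u finite_row_pairs in auto)
      finally show ?thesis .
    next
      case False
      then obtain v where v: "v \<in> ?R" "x \<in> violators f C v" "v \<noteq> u"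
        using u unfolding single_violators_def by auto
      have "2 \<le> ?h x u + ?h x v" using u v by simp
      also have "\<dots> = (\<Sum>w\<in>{u, v}. ?h x w)" using v(3) by simp
      also have "\<dots> \<le> (\<Sum>u\<in>?R. ?h x u)" by (rule sum_mono2) (use u v finite_row_pairs in auto)
      finally show ?thesis .
    qed
  qed
  have "2 * card ?B = (\<Sum>x\<in>?B. 2)" by simp
  also have "\<dots> \<le> (\<Sum>x\<in>?B. \<Sum>u\<in>?R. ?h x u)" by (rule sum_mono) (rule two)
  also have "\<dots> \<le> (\<Sum>x\<in>C. \<Sum>u\<in>?R. ?h x u)" by (rule sum_mono2) (use assms in auto)
  also have "\<dots> = (\<Sum>u\<in>?R. \<Sum>x\<in>C. ?h x u)" by (rule sum.swap)
  also have "\<dots> = (\<Sum>u\<in>?R. card (violators f C u) + card (single_violators m f C u))"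
  proof (rule sum.cong[OF refl])
    fix u
    have "C \<inter> violators f C u = violators f C u" "C \<inter> single_violators m f C u = single_violators m f C u"
      unfolding violators_def single_violators_def by auto
    then show "(\<Sum>x\<in>C. ?h x u) = card (violators f C u) + card (single_violators m f C u)"
      using assms by (simp add: sum.distrib flip: sum.inter_restrict)
  qed
  finally have "2 * card ?B \<le> (\<Sum>u\<in>?R. card (violators f C u) + card (single_violators m f C u))" .
  moreover have "card C = card (satisfying m f C) + card ?B"
    using assms satisfying_subset[of m f C] by (metis card_Diff_subset card_mono finite_subset le_add_diff_inverse)
  ultimately show ?thesis by simp
qed

lemma median_condition_strict_order:
  assumes "median_condition m f"
  shows "strict_order_on {..<m} (aligned f)"
  unfolding strict_order_on_def
proof (intro conjI ballI impI)
  fix x y z assume h: "x \<in> {..<m}" "y \<in> {..<m}" "z \<in> {..<m}" "aligned f x y" "aligned f y z"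
  have ne: "x \<noteq> y" "y \<noteq> z" "x \<noteq> z" using h(4,5) unfolding aligned_def by auto
  have "f y x = f y z \<or> f x y = f x z" "f y z = f y x \<or> f z y = f z x"
    using assms h(1-3) ne unfolding median_condition_def by (metis lessThan_iff)+
  then show "aligned f x z" using h(4,5) unfolding aligned_def by auto
qed (auto simp: aligned_def)

text \<open>Such a column has 1 in row \<open>i\<close> and 0 in row \<open>j\<close>. A row
  \<open>k\<close> strictly between must have entry 2: a 0 would complete the rare pattern with
  \<open>i\<close>, a 1 that with \<open>j\<close>. For any other row the median condition makes the
  entry of \<open>i\<close> or of \<open>j\<close> the rare one against \<open>k\<close>, which
  excludes one of 0 and 1 and leaves two choices.\<close>

lemma card_single_violators:
  assumes C: "C \<subseteq> columns m" and med: "median_condition m f"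
    and ij: "i < m" "j < m" "aligned f i j"
  shows "card (single_violators m f C (i, j)) \<le>
     2 ^ card {k \<in> {..<m}. k \<noteq> i \<and> k \<noteq> j \<and> \<not> (aligned f i k \<and> aligned f k j)}" (is "card ?S \<le> 2 ^ card ?O")
proof -
  have nij: "i \<noteq> j" using ij(3) unfolding aligned_def by auto
  have f: "f i j" "\<not> f j i" using ij(3) unfolding aligned_def by auto
  define val :: "nat \<Rightarrow> nat" where "val k = (if f i k then of_bool (\<not> f k i) else of_bool (\<not> f k j))" for k
  have xC: "x \<in> C" "x \<in> columns m" "x ! i = 1" "x ! j = 0" if "x \<in> ?S" for x
    using that C f unfolding single_violators_def violators_def violates_def by auto
  have only: "\<not> violates f x h k" if x: "x \<in> ?S" and k: "h \<in> {i, j}" "k < m" "k \<noteq> i" "k \<noteq> j" for x h k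
  proof
    assume v: "violates f x h k"
    have "h < m" "h \<noteq> k" using k ij by auto
    then obtain u where u: "u \<in> row_pairs m f" "u = (h, k) \<or> u = (k, h)"
      using row_pairs_cases[of h m k f] k(2) by blast
    then have "x \<in> violators f C u" unfolding violators_def using v violates_sym[of f x h k] xC(1)[OF x] by auto
    then have "u = (i, j)" using u(1) x unfolding single_violators_def by blast
    then show False using u(2) k by auto
  qed
  have between: "x ! k = 2" if x: "x \<in> ?S" and k: "k < m" "aligned f i k" "aligned f k j" for x k
  proof -
    have "k \<noteq> i" "k \<noteq> j" using k unfolding aligned_def by auto
    then have "\<not> violates f x i k" "\<not> violates f x j k" using only[OF x, of _ k] k(1) by auto
    then have "x ! k \<noteq> 0" "x ! k \<noteq> 1" using k xC(3,4)[OF x] unfolding violates_def aligned_def by auto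
    then show ?thesis using columns_nth[OF xC(2)[OF x] k(1)] by auto
  qed
  have outside: "x ! k = val k \<or> x ! k = 2" if x: "x \<in> ?S" and k: "k \<in> ?O" for x k
  proof -
    have k': "k < m" "k \<noteq> i" "k \<noteq> j" using k by auto
    have nv: "\<not> violates f x i k" "\<not> violates f x j k" using only[OF x, of _ k] k' by auto
    have "f i j = f i k \<or> f j i = f j k"
      using med ij k' nij unfolding median_condition_def by blast
    then have "f i k \<or> \<not> f j k" using f by simp
    then have "x ! k \<noteq> (if f i k then of_bool (f k i) else of_bool (f k j))"
      using nv xC(3,4)[OF x] unfolding violates_def by (auto split: if_splits)
    then show ?thesis using columns_nth[OF xC(2)[OF x] k'(1)] unfolding val_def
      by (auto split: if_splits simp: of_bool_def)
  qed
  let ?g = "\<lambda>x. {k \<in> ?O. x ! k \<noteq> 2}"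
  have "inj_on ?g ?S"
  proof (rule inj_onI)
    fix x y assume xy: "x \<in> ?S" "y \<in> ?S" "?g x = ?g y"
    show "x = y"
    proof (rule columns_eqI[OF xC(2)[OF xy(1)] xC(2)[OF xy(2)]])
      fix k assume k: "k < m"
      consider "k = i" | "k = j" | "aligned f i k" "aligned f k j" | "k \<in> ?O" using k by auto
      then show "x ! k = y ! k"
      proof cases
        case 4
        then have "x ! k = 2 \<longleftrightarrow> y ! k = 2" using xy(3) by blast
        then show ?thesis using outside[OF xy(1) 4] outside[OF xy(2) 4] by auto
      qed (use xC(3,4)[OF xy(1)] xC(3,4)[OF xy(2)] between[OF xy(1) k] between[OF xy(2) k] in auto)
    qed
  qed
  then have "card ?S = card (?g ` ?S)" by (simp add: card_image)
  also have "\<dots> \<le> card (Pow ?O)" by (rule card_mono) auto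
  finally show ?thesis by (simp add: card_Pow)
qed

text \<open>With this, the hypothesis \<open>2 * NN r + 2 \<le> m\<close> also bounds
  \<open>m\<close> below in terms of \<open>r\<close>.\<close>

lemma le_NN: "r \<le> NN r"
proof -
  have c: "n \<le> Suc n choose 2" for n by (cases n) (auto simp: numeral_2_eq_2)
  have "NN r = (Suc ((r + 1) div 2) choose 2) + (Suc (r div 2) choose 2)" unfolding NN_def by simp
  then show ?thesis using c[of "(r + 1) div 2"] c[of "r div 2"] by linarith
qed

section \<open>Counting against the capacities of the pairs\<close>

locale sparse_patterns =
  fixes m P q :: nat and C :: "nat list set" and f :: "nat \<Rightarrow> nat \<Rightarrow> bool"
  assumes columns: "C \<subseteq> columns m" and q_le: "q \<le> P"
    and sparse: "\<And>i j. i < m \<Longrightarrow> j < m \<Longrightarrow> i \<noteq> j \<Longrightarrow>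
      card {x \<in> C. violates f x i j} \<le> (if f i j = f j i then P - q else P)"
begin

abbreviation weight :: "nat \<times> nat \<Rightarrow> nat" where
  "weight u \<equiv> card (violators f C u) + card (single_violators m f C u)"

lemma finite_C: "finite C"
  using columns finite_columns finite_subset by blast

lemma card_single_le: "card (single_violators m f C u) \<le> card (violators f C u)"
  by (rule card_mono) (use finite_C in \<open>auto simp: single_violators_def violators_def\<close>)

lemma card_violators_le:
  assumes "u \<in> row_pairs m f"
  shows "card (violators f C u) \<le> P" "u \<in> unaligned_pairs m f \<Longrightarrow> card (violators f C u) \<le> P - q"
proof -
  obtain i j where u: "u = (i, j)" by (cases u)
  have "card (violators f C u) \<le> (if f i j = f j i then P - q else P)"
    using sparse[of i j] assms unfolding u violators_def row_pairs_def by auto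
  then show "card (violators f C u) \<le> P" "u \<in> unaligned_pairs m f \<Longrightarrow> card (violators f C u) \<le> P - q"
    unfolding u unaligned_pairs_def by (auto split: if_splits)
qed

text \<open>In the doubled count a pair contributes at most \<open>2 * P\<close>. An unaligned pair
  saves \<open>2 * q\<close>, because both of its summands are at most \<open>P - q\<close>; a pair
  of \<open>K\<close> saves \<open>y\<close> in the second summand only.\<close>

lemma weighted_bound:
  assumes "K \<subseteq> row_pairs m f - unaligned_pairs m f"
    and "\<And>u. u \<in> K \<Longrightarrow> int (card (single_violators m f C u)) \<le> int P - y"
  shows "2 * int (card C) + 2 * int q * int (card (unaligned_pairs m f)) + y * int (card K)
     \<le> 2 * int (card (satisfying m f C)) + 2 * int P * int (m choose 2)"
proof -
  let ?R = "row_pairs m f" and ?U = "unaligned_pairs m f"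
  let ?b = "\<lambda>u. 2 * int P - (if u \<in> ?U then 2 * int q else 0) - (if u \<in> K then y else 0)"
  have "(\<Sum>u\<in>?R. int (weight u)) \<le> (\<Sum>u\<in>?R. ?b u)"
  proof (rule sum_mono)
    fix u assume u: "u \<in> ?R"
    consider "u \<in> ?U" "u \<notin> K" | "u \<in> K" "u \<notin> ?U" | "u \<notin> ?U" "u \<notin> K" using assms(1) by blast
    then show "int (weight u) \<le> ?b u"
    proof cases
      case 1
      have "int (card (violators f C u)) \<le> int P - int q"
        using card_violators_le(2)[OF u 1(1)] q_le by linarith
      then show ?thesis using card_single_le[of u] 1 by simp
    next
      case 2
      then show ?thesis using card_violators_le(1)[OF u] assms(2)[OF 2(1)] by simp
    next
      case 3
      then show ?thesis using card_violators_le(1)[OF u] card_single_le[of u] by simp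
    qed
  qed
  also have "\<dots> = 2 * int P * int (m choose 2) - 2 * int q * int (card ?U) - y * int (card K)"
  proof -
    have "?R \<inter> ?U = ?U" "?R \<inter> K = K" using unaligned_pairs_subset[of m f] assms(1) by auto
    then show ?thesis using finite_row_pairs[of m f] card_row_pairs[of m f]
      by (simp add: sum_subtractf flip: sum.inter_restrict)
  qed
  finally have "int (\<Sum>u\<in>?R. weight u) \<le> 2 * int P * int (m choose 2) - 2 * int q * int (card ?U) - y * int (card K)"
    by simp
  moreover have "int (2 * card C) \<le> int (2 * card (satisfying m f C) + (\<Sum>u\<in>?R. weight u))"
    using twice_card_le[OF finite_C, of m f] by (simp only: of_nat_le_iff)
  ultimately show ?thesis by (simp only: of_nat_add of_nat_mult of_nat_numeral)
qed

lemma trivial_bound: "card C \<le> card (satisfying m f C) + P * (m choose 2)"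
proof -
  have "2 * int (card C) + 2 * int q * int (card (unaligned_pairs m f)) \<le>
     2 * int (card (satisfying m f C)) + 2 * int P * int (m choose 2)"
    using weighted_bound[of "{}" 0] by simp
  moreover have "0 \<le> 2 * int q * int (card (unaligned_pairs m f))" by simp
  ultimately have "2 * int (card C) \<le> 2 * int (card (satisfying m f C)) + 2 * int P * int (m choose 2)"
    by linarith
  then have "int (card C) \<le> int (card (satisfying m f C) + P * (m choose 2))" by simp
  then show ?thesis by (simp only: of_nat_le_iff)
qed

theorem card_upper_bound:
  assumes P_le: "P \<le> 2 ^ r" and less_P: "1 \<le> r \<Longrightarrow> 2 ^ (r - 1) < P" and m: "2 * NN r + 2 \<le> m"
    and cond: "1 \<le> r \<Longrightarrow> 2 ^ (r - 1) + 2 * q \<le> P \<or>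
        8 * (q * NN r) \<le> 2 ^ r \<and> 2 * q \<le> (r div 2 + 1) * (P - 2 ^ (r - 1))"
  shows "card C + q * NN r \<le> base m + P * (m choose 2)"
proof -
  let ?U = "unaligned_pairs m f" and ?N = "NN r"
  have sat: "card (satisfying m f C) \<le> base m" by (rule card_satisfying_base[OF columns])
  \<comment> \<open>What remains is to find aligned pairs whose savings make up for the unaligned
    pairs missing from \<open>NN r\<close>; an unaligned pair is worth \<open>2 * q\<close>
    here.\<close>
  have enough: ?thesis if K: "K \<subseteq> row_pairs m f - ?U"
      "\<And>u. u \<in> K \<Longrightarrow> int (card (single_violators m f C u)) \<le> int P - y"
      and N: "2 * int q * int ?N \<le> 2 * int q * int (card ?U) + y * int (card K)" for K y
  proof -
    have "2 * int (card C) + 2 * int q * int ?N \<le> 2 * int (base m) + 2 * int P * int (m choose 2)"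
      using weighted_bound[OF K] N sat by linarith
    then have "int (card C + q * ?N) \<le> int (base m + P * (m choose 2))" by simp
    then show ?thesis by (simp only: of_nat_le_iff)
  qed
  consider "r = 0" | "1 \<le> r" "\<not> median_condition m f" | "1 \<le> r" "median_condition m f" by linarith
  then show ?thesis
  proof cases
    case 1
    then have "?N = 0" by (simp add: NN_def numeral_2_eq_2)
    then show ?thesis using trivial_bound sat by simp
  next
    case 2
    have N1: "1 \<le> ?N" using le_NN[of r] 2(1) by simp
    \<comment> \<open>Origin of the bound on \<open>m\<close>: as
      \<open>q \<le> 2 ^ r \<le> 2 ^ ?N\<close> and \<open>?N \<le> 2 ^ (?N - 1)\<close>, the target
      loss \<open>q * ?N\<close> is at most \<open>2 ^ (2 * ?N - 1)\<close>, and
      \<open>m - 3 \<ge> 2 * ?N - 1\<close>.\<close>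
    have "q \<le> 2 ^ ?N" using q_le P_le power_increasing[OF le_NN[of r], of "2::nat"] by linarith
    moreover have "?N \<le> 2 ^ (?N - 1)" using less_exp[of "?N - 1"] N1 by linarith
    ultimately have "q * ?N \<le> 2 ^ ?N * 2 ^ (?N - 1)" by (rule mult_le_mono)
    also have "\<dots> = 2 ^ (?N + (?N - 1))" by (simp add: power_add)
    also have "\<dots> \<le> 2 ^ (m - 3)" by (rule power_increasing) (use m N1 in auto)
    finally show ?thesis using card_satisfying_deficit[OF columns 2(2)] trivial_bound by linarith
  next
    case 3
    \<comment> \<open>Since \<open>a + b - 2 = r\<close>, a pair across \<open>X\<close> and
      \<open>Y\<close> has at most \<open>r\<close> rows outside, reduced by its two values. The
      split is as even as possible, as for the leaves of the extremal tree.\<close>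
    define a where "a = (r + 1) div 2 + 1"
    define b where "b = r div 2 + 1"
    have ab: "a + b = r + 2" unfolding a_def b_def by linarith
    have N: "?N = (a choose 2) + (b choose 2)" unfolding NN_def a_def b_def by simp
    have "a + b \<le> card {..<m}" using ab m le_NN[of r] by simp
    from many_incomparable_or_extremal_sets[OF _ median_condition_strict_order[OF 3(2)] this]
    consider "m + 1 \<le> card ?U + a + b"
      | X Y \<alpha> \<beta> where "X \<subseteq> {..<m}" "Y \<subseteq> {..<m}" "card X = a" "card Y = b" "capped X \<alpha>" "capped Y \<beta>"
       "int ?N \<le> sum \<alpha> X + sum \<beta> Y + int (card ?U)"
       "\<forall>i\<in>X. \<forall>j\<in>Y. aligned f i j \<and>
          int (card {k \<in> {..<m}. k \<noteq> i \<and> k \<noteq> j \<and> \<not> (aligned f i k \<and> aligned f k j)}) + \<alpha> i + \<beta> j \<le> int a + int b - 2"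
      unfolding card_unaligned_pairs N by auto
    then show ?thesis
    proof cases
      case 1
      \<comment> \<open>There are at least \<open>m - r - 1\<close> unaligned pairs, and both
        \<open>2 * ?N + 2 \<le> m\<close> and \<open>r \<le> ?N\<close> hold.\<close>
      then have "?N \<le> card ?U" using ab m le_NN[of r] by linarith
      then have "2 * int q * int ?N \<le> 2 * int q * int (card ?U)" by (intro mult_left_mono) auto
      then show ?thesis by (intro enough[of "{}" 0]) auto
    next
      case (2 X Y \<alpha> \<beta>)
      have fin: "finite X" "finite Y" using 2(1,2) finite_subset by auto
      have al: "(i, j) \<in> row_pairs m f - ?U" if "i \<in> X" "j \<in> Y" for i j
      proof -
        have "aligned f i j" "i < m" "j < m" using 2(1,2,8) that by auto
        then show ?thesis unfolding row_pairs_def unaligned_pairs_def aligned_def by auto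
      qed
      have single: "card (single_violators m f C (i, j)) \<le> 2 ^ (r - nat c)"
        if "i \<in> X" "j \<in> Y" "c \<le> \<alpha> i + \<beta> j" "0 \<le> c" for i j c
      proof -
        let ?O = "{k \<in> {..<m}. k \<noteq> i \<and> k \<noteq> j \<and> \<not> (aligned f i k \<and> aligned f k j)}"
        have "int (card ?O) + \<alpha> i + \<beta> j \<le> int r" using 2(8) that(1,2) ab by fastforce
        then have "card ?O \<le> r - nat c" using that(3,4) by linarith
        then have "(2::nat) ^ card ?O \<le> 2 ^ (r - nat c)" by (intro power_increasing) auto
        moreover have "card (single_violators m f C (i, j)) \<le> 2 ^ card ?O"
          by (rule card_single_violators[OF columns 3(2)]) (use 2(1,2,8) that in auto)
        ultimately show ?thesis by linarith
      qed
      let ?K = "cells X \<alpha> Y \<beta>"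
      have K: "?K \<subseteq> row_pairs m f - ?U" unfolding cells_def using al by auto
      have K1: "card (single_violators m f C u) \<le> 2 ^ (r - 1)" if "u \<in> ?K" for u
        using that single[of _ _ 1] unfolding cells_def by auto
      show ?thesis
      proof (cases "2 ^ (r - 1) + 2 * q \<le> P")
        case True
        \<comment> \<open>In case (i) a cell has at most \<open>2 ^ (r - 1) \<le> P - 2 * q\<close>
          single violators and saves as much as an unaligned pair, so it suffices to count cells and
          unaligned pairs together.\<close>
        have "sum \<alpha> X + sum \<beta> Y \<le> int (card ?K)"
          by (rule sum_le_card_cells[OF fin _ _ 2(5,6)]) (auto simp: 2(3,4) a_def b_def)
        then have "int ?N \<le> int (card ?U) + int (card ?K)" using 2(7) by linarith
        then have "2 * int q * int ?N \<le> 2 * int q * (int (card ?U) + int (card ?K))"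
          by (intro mult_left_mono) auto
        moreover have "int (card (single_violators m f C u)) \<le> int P - 2 * int q" if "u \<in> ?K" for u
          using K1[OF that] True by linarith
        ultimately show ?thesis by (intro enough[OF K, of "2 * int q"]) (auto simp: algebra_simps)
      next
        case False
        then have ii: "8 * (q * ?N) \<le> 2 ^ r" "2 * q \<le> b * (P - 2 ^ (r - 1))"
          using cond[OF 3(1)] unfolding b_def by auto
        define y where "y = int P - 2 ^ (r - 1)"
        have P_gt: "int P > 2 ^ (r - 1)" using less_P[OF 3(1)] by (simp flip: of_nat_less_iff)
        show ?thesis
        \<comment> \<open>A pair with value at least 2 has at most \<open>2 ^ (r - 2)\<close> single
          violators and saves \<open>P - 2 ^ (r - 2) > 2 ^ (r - 2) \<ge> 2 * q * ?N\<close>, the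
          whole amount. This is the purpose of the first inequality in (ii).\<close>
        proof (cases "\<exists>i\<in>X. \<exists>j\<in>Y. 2 \<le> \<alpha> i + \<beta> j")
          case True
          then obtain i j where ij: "i \<in> X" "j \<in> Y" "2 \<le> \<alpha> i + \<beta> j" by blast
          have s2: "card (single_violators m f C (i, j)) \<le> 2 ^ (r - 2)" using single[OF ij(1,2), of 2] ij(3) by simp
          have "0 \<le> int (card {k \<in> {..<m}. k \<noteq> i \<and> k \<noteq> j \<and> \<not> (aligned f i k \<and> aligned f k j)})" by simp
          \<comment> \<open>The number of rows outside is at least 0 and at most \<open>r\<close>
            minus the value of the pair; so \<open>r - 2\<close> is a genuine subtraction.\<close>
          then have "2 \<le> int r" using 2(8) ij ab by fastforce
          then obtain s where r: "r = s + 2" by (metis add.commute le_Suc_ex nat_int_comparison(3) of_nat_numeral)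
          have "2 * int q * int ?N \<le> 2 ^ s"
          proof -
            have "8 * (q * ?N) \<le> 4 * 2 ^ s" using ii(1) unfolding r by (simp add: power_add)
            then have "2 * q * ?N \<le> 2 ^ s" by simp
            then have "int (2 * q * ?N) \<le> int (2 ^ s)" by (simp only: of_nat_le_iff)
            then show ?thesis by simp
          qed
          moreover have "2 * 2 ^ s < int P" using P_gt unfolding r by simp
          moreover have "0 \<le> (2::int) ^ s" by simp
          moreover have "int (card (single_violators m f C (i, j))) \<le> 2 ^ s"
            using s2 unfolding r by (simp flip: of_nat_le_iff)
          moreover have "0 \<le> 2 * int q * int (card ?U)" by simp
          ultimately have "2 * int q * int ?N \<le> 2 * int q * int (card ?U) + (int P - 2 ^ s)"
            "int (card (single_violators m f C (i, j))) \<le> int P - (int P - 2 ^ s)"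
            by linarith+
          then show ?thesis
            by (intro enough[of "{(i, j)}" "int P - 2 ^ s"]) (use al[OF ij(1,2)] in auto)
        next
          case False
          then have "\<alpha> i + \<beta> j \<le> 1" if "i \<in> X" "j \<in> Y" for i j using that by force
          \<comment> \<open>With all values at most 1 there are \<open>b\<close> cells for each unit
            of the sum. Each saves only \<open>y\<close>, but \<open>b * y \<ge> 2 * q\<close> by
            the second inequality in (ii).\<close>
          then have le: "int b * (sum \<alpha> X + sum \<beta> Y) \<le> int (card ?K)"
            using scaled_sum_le_card_cells[OF fin _ 2(5)] 2(3,4) unfolding a_def b_def
            by (metis add_Suc_right div2_Suc_Suc Suc_eq_plus1 even_Suc_div_two odd_Suc_div_two)
          have by2: "2 * int q \<le> int b * y"
          proof -
            have "int (P - 2 ^ (r - 1)) = y" using P_gt less_P[OF 3(1)] unfolding y_def by (simp add: of_nat_diff)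
            moreover have "int (2 * q) \<le> int (b * (P - 2 ^ (r - 1)))" using ii(2) by (simp only: of_nat_le_iff)
            ultimately show ?thesis by simp
          qed
          have y0: "0 \<le> y" using P_gt unfolding y_def by simp
          have "2 * int q * int ?N \<le> 2 * int q * int (card ?U) + y * int (card ?K)"
          \<comment> \<open>Replacing \<open>2 * q\<close> by \<open>b * y\<close> needs a
            nonnegative factor; if the sum is negative, the unaligned pairs alone suffice.\<close>
          proof (cases "0 \<le> sum \<alpha> X + sum \<beta> Y")
            case True
            have "2 * int q * int ?N \<le> 2 * int q * (sum \<alpha> X + sum \<beta> Y + int (card ?U))"
              using 2(7) by (intro mult_left_mono) auto
            also have "\<dots> = 2 * int q * int (card ?U) + 2 * int q * (sum \<alpha> X + sum \<beta> Y)" by (simp add: algebra_simps)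
            also have "2 * int q * (sum \<alpha> X + sum \<beta> Y) \<le> int b * y * (sum \<alpha> X + sum \<beta> Y)"
              by (rule mult_right_mono[OF by2 True])
            also have "\<dots> = y * (int b * (sum \<alpha> X + sum \<beta> Y))" by simp
            also have "\<dots> \<le> y * int (card ?K)" by (rule mult_left_mono[OF le y0])
            finally show ?thesis by simp
          next
            case False
            then have "2 * int q * int ?N \<le> 2 * int q * int (card ?U)"
              using 2(7) by (intro mult_left_mono) auto
            moreover have "0 \<le> y * int (card ?K)" using y0 by simp
            ultimately show ?thesis by linarith
          qed
          moreover have "int (card (single_violators m f C u)) \<le> int P - y" if "u \<in> ?K" for u
            using K1[OF that] unfolding y_def by (simp flip: of_nat_le_iff)
          ultimately show ?thesis by (intro enough[OF K])
        qed
      qed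
    qed
  qed
qed

end

subsection \<open>The lower bound\<close>

text \<open>Rows below \<open>a\<close> and rows from \<open>t\<close> on are the leaves at the two ends of the tree (sparse patterns
  11 and 00, respectively); all other pairs of rows \<open>i < j\<close> have the sparse pattern 10.\<close>
definition broom :: "nat \<Rightarrow> nat \<Rightarrow> nat \<Rightarrow> nat \<Rightarrow> bool" where
  "broom a t i j \<longleftrightarrow> i < a \<and> j < a \<or> \<not> (t \<le> i \<and> t \<le> j) \<and> i < j"

text \<open>Rows are the edges of the tree, and a column records on which side of each edge of the
  support a fixed vertex lies, the edges outside the support being contracted. An index below
  \<open>a\<close> or from \<open>t\<close> on names the vertex at the end of that leaf, an index in
  between the vertex before that path edge, and \<open>m\<close> the vertex carrying the upper
  leaves.\<close>

definition tree_column :: "nat \<Rightarrow> nat \<Rightarrow> nat \<Rightarrow> nat set \<times> nat \<Rightarrow> nat list" where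
  "tree_column m a t z = map (\<lambda>i. if i \<notin> fst z then 2 else if i < a then of_bool (i = snd z)
     else if i < t then of_bool (snd z \<le> i) else of_bool (i \<noteq> snd z)) [0..<m]"

text \<open>Leaves are minimal or maximal in the order of the broom, so only path rows can lie
  strictly between \<open>i\<close> and \<open>j\<close>.\<close>

definition free_rows :: "nat \<Rightarrow> nat \<Rightarrow> nat \<Rightarrow> nat \<Rightarrow> nat \<Rightarrow> nat set" where
  "free_rows m a t i j = {k. k < m \<and> k \<noteq> i \<and> k \<noteq> j \<and> \<not> (a \<le> k \<and> k < t \<and> i < k \<and> k < j)}"

text \<open>The pair \<open>u\<close> gets its rare pattern. A free row in \<open>U\<close> gets the
  value that completes no further rare pattern: 0 for lower leaves and path rows before the pair, 1
  for upper leaves and path rows after it.\<close>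

definition extra_column :: "nat \<Rightarrow> nat \<Rightarrow> nat \<Rightarrow> nat \<times> nat \<Rightarrow> nat set \<Rightarrow> nat list" where
  "extra_column m a t u U = map (\<lambda>k. if k = fst u then of_bool (broom a t (fst u) (snd u))
     else if k = snd u then of_bool (broom a t (snd u) (fst u))
     else if k \<notin> U then 2 else if k < a then 0 else if t \<le> k then 1 else of_bool (snd u < k)) [0..<m]"

lemma map_upt_in_columns: "(\<And>k. k < m \<Longrightarrow> g k < 3) \<Longrightarrow> map g [0..<m] \<in> columns m"
  unfolding columns_def by auto

lemma tree_column_in: "tree_column m a t z \<in> columns m"
  unfolding tree_column_def by (rule map_upt_in_columns) auto

lemma extra_column_in: "extra_column m a t u U \<in> columns m"
  unfolding extra_column_def by (rule map_upt_in_columns) auto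

lemma tree_column_not_violates:
  assumes "a \<le> t" "i < m" "j < m" "i \<noteq> j"
  shows "\<not> violates (broom a t) (tree_column m a t z) i j"
proof -
  have "\<not> violates (broom a t) (tree_column m a t z) i j" if "i < j" "j < m" for i j
    using that assms(1) by (auto simp: violates_def tree_column_def broom_def of_bool_def split: if_splits)
  then show ?thesis using assms violates_sym[of _ _ i j] by (cases "i < j") auto
qed

lemma extra_column_violates_iff:
  assumes "a \<le> t" "i < j" "j < m" "U \<subseteq> free_rows m a t i j" "k < l" "l < m"
  shows "violates (broom a t) (extra_column m a t (i, j) U) k l \<longleftrightarrow> k = i \<and> l = j"
proof -
  have "h \<in> U \<Longrightarrow> h \<noteq> i \<and> h \<noteq> j \<and> \<not> (a \<le> h \<and> h < t \<and> i < h \<and> h < j)" for h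
    using assms(4) unfolding free_rows_def by auto
  from this[of k] this[of l] show ?thesis
    using assms(1-3,5,6)
    by (auto simp: violates_def extra_column_def broom_def of_bool_def split: if_splits)
qed

lemma inj_on_tree_column: "inj_on (tree_column m a t) (Sigma (Pow {..<m}) (\<lambda>S. insert m S))"
proof (rule inj_onI)
  fix y z assume yz: "y \<in> Sigma (Pow {..<m}) (\<lambda>S. insert m S)" "z \<in> Sigma (Pow {..<m}) (\<lambda>S. insert m S)"
    "tree_column m a t y = tree_column m a t z"
  have eq: "(tree_column m a t y) ! i = (tree_column m a t z) ! i" for i using yz(3) by simp
  have "i \<in> fst y \<longleftrightarrow> i \<in> fst z" if "i < m" for i
    using eq[of i] that by (auto simp: tree_column_def of_bool_def split: if_splits)
  then have fst: "fst y = fst z" using yz(1,2) by fastforce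
  \<comment> \<open>The smaller of two different indices is a row of the common support, and the two
    columns differ in that row.\<close>
  have "\<not> snd v < snd w" if "v \<in> {y, z}" "w \<in> {y, z}" for v w
  proof
    assume lt: "snd v < snd w"
    have "snd w \<le> m" using that yz(1,2) by auto
    then have v: "snd v < m" "snd v \<in> fst v" using lt that yz(1,2) by auto
    have "fst v = fst w" "(tree_column m a t v) ! snd v = (tree_column m a t w) ! snd v"
      using that fst yz(3) by auto
    then show False using lt v by (auto simp: tree_column_def of_bool_def split: if_splits)
  qed
  then have "snd y = snd z" by (metis insertCI nat_neq_iff)
  then show "y = z" using fst by (rule prod_eqI[rotated])
qed

lemma card_tree_columns: "card (tree_column m a t ` Sigma (Pow {..<m}) (\<lambda>S. insert m S)) = base m"
proof -
  have "card (tree_column m a t ` Sigma (Pow {..<m}) (\<lambda>S. insert m S)) = card (Sigma (Pow {..<m}) (\<lambda>S. insert m S))"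
    by (rule card_image[OF inj_on_tree_column])
  also have "\<dots> = (\<Sum>S\<in>Pow {..<m}. card (insert m S))"
    by (rule card_SigmaI) (auto intro: finite_subset)
  also have "\<dots> = base m" unfolding base_def
  proof (rule sum.cong[OF refl])
    fix S assume "S \<in> Pow {..<m}"
    then have "finite S" "m \<notin> S" using finite_subset by auto
    then show "card (insert m S) = card S + 1" by simp
  qed
  finally show ?thesis .
qed

lemma inj_on_extra_column:
  assumes "i < j" "j < m"
  shows "inj_on (extra_column m a t (i, j)) (Pow (free_rows m a t i j))"
proof (rule inj_onI)
  fix U V assume UV: "U \<in> Pow (free_rows m a t i j)" "V \<in> Pow (free_rows m a t i j)"
    "extra_column m a t (i, j) U = extra_column m a t (i, j) V"
  have "k \<in> U \<longleftrightarrow> k \<in> V" if k: "k \<in> free_rows m a t i j" for k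
  proof -
    have "extra_column m a t (i, j) U ! k = extra_column m a t (i, j) V ! k" using UV(3) by simp
    then show ?thesis using k by (auto simp: extra_column_def free_rows_def of_bool_def split: if_splits)
  qed
  then show "U = V" using UV(1,2) by blast
qed

lemma card_free_rows:
  assumes "a \<le> t" "t \<le> m" "i < m" "j < m"
  shows "m \<le> card (free_rows m a t i j) + 2 + (t - a)"
proof -
  have "{..<m} \<subseteq> free_rows m a t i j \<union> ({i, j} \<union> {a..<t})" unfolding free_rows_def by auto
  moreover have f: "finite (free_rows m a t i j)" unfolding free_rows_def by simp
  ultimately have "card {..<m} \<le> card (free_rows m a t i j \<union> ({i, j} \<union> {a..<t}))" by (intro card_mono) auto
  also have "\<dots> \<le> card (free_rows m a t i j) + (card {i, j} + card {a..<t})"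
    using card_Un_le[of "free_rows m a t i j" "{i, j} \<union> {a..<t}"] card_Un_le[of "{i, j}" "{a..<t}"] by linarith
  also have "card {i, j} \<le> 2" by (simp add: card_insert_if)
  finally show ?thesis by simp
qed

lemma row_pairs_broom: "a \<le> t \<Longrightarrow> row_pairs m (broom a t) = {(i, j). i < j \<and> j < m}"
  unfolding row_pairs_def aligned_def broom_def by auto

lemma card_increasing_pairs: "card {(i, j). i < j \<and> j < n} = n choose 2"
proof -
  have "{(i, j). i < j \<and> j < n} = row_pairs n (\<lambda>_ _. True)" unfolding row_pairs_def aligned_def by auto
  then show ?thesis by (simp add: card_row_pairs)
qed

lemma card_unaligned_pairs_broom:
  assumes "a \<le> t" "t \<le> m"
  shows "card (unaligned_pairs m (broom a t)) = (a choose 2) + (m - t choose 2)"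
proof -
  let ?A = "{(i, j). i < j \<and> j < a}" and ?B = "(\<lambda>(i, j). (i + t, j + t)) ` {(i, j). i < j \<and> j < m - t}"
  have B: "?B = {(i, j). t \<le> i \<and> i < j \<and> j < m}"
  proof (intro subset_antisym subsetI)
    fix u assume "u \<in> {(i, j). t \<le> i \<and> i < j \<and> j < m}"
    then obtain i j where "u = (i, j)" "t \<le> i" "i < j" "j < m" by blast
    then show "u \<in> ?B" by (intro image_eqI[of _ _ "(i - t, j - t)"]) auto
  qed auto
  have "unaligned_pairs m (broom a t) = ?A \<union> ?B"
    unfolding B using assms by (auto simp: unaligned_pairs_def broom_def)
  moreover have "finite ?A" by (rule finite_subset[of _ "{..<a} \<times> {..<a}"]) auto
  moreover have f: "finite {(i, j). i < j \<and> j < m - t}"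
    by (rule finite_subset[of _ "{..<m - t} \<times> {..<m - t}"]) auto
  moreover have "?A \<inter> ?B = {}" unfolding B using assms by auto
  ultimately have "card (unaligned_pairs m (broom a t)) = card ?A + card ?B"
    by (simp add: card_Un_disjoint)
  also have "card ?B = card {(i, j). i < j \<and> j < m - t}" by (rule card_image) (auto simp: inj_on_def)
  finally show ?thesis by (simp add: card_increasing_pairs)
qed

theorem ex_large_family:
  assumes q: "q \<le> P" and P: "P \<le> 2 ^ r" and m: "r + 2 \<le> m"
  shows "\<exists>C\<subseteq>columns m. \<not> contains m (P + 1 - q) (P + 1) (P + 1) (P + 1 - q) C \<and>
    card C + q * NN r = base m + P * (m choose 2)"
proof -
  define a where "a = (r + 1) div 2 + 1"
  define b where "b = r div 2 + 1"
  define t where "t = m - b"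
  have ab: "a + b = r + 2" unfolding a_def b_def by linarith
  have at: "a \<le> t" "t \<le> m" "m - t = b" unfolding t_def using ab m by auto
  let ?f = "broom a t"
  let ?R = "row_pairs m ?f"
  define cap where "cap u = (if u \<in> unaligned_pairs m ?f then P - q else P)" for u
  let ?X = "\<lambda>u. extra_column m a t u ` Pow (free_rows m a t (fst u) (snd u))"
  have R: "?R = {(i, j). i < j \<and> j < m}" by (rule row_pairs_broom[OF at(1)])
  have "\<exists>E. E \<subseteq> ?X u \<and> card E = cap u" if uR: "u \<in> ?R" for u
  proof -
    obtain i j where u: "u = (i, j)" "i < j" "j < m" using uR unfolding R by auto
    have "cap u \<le> 2 ^ r" unfolding cap_def using P by auto
    \<comment> \<open>At least \<open>m - 2 - (t - a) = a + b - 2 = r\<close> rows are free, so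
      every pair has \<open>2 ^ r \<ge> P\<close> columns of its own. This fixes the total number of
      leaves as \<open>r + 2\<close>.\<close>
    also have "\<dots> \<le> 2 ^ card (free_rows m a t i j)"
      by (rule power_increasing) (use card_free_rows[OF at(1,2), of i j] u ab at in auto)
    also have "\<dots> = card (?X u)"
      using card_image[OF inj_on_extra_column[OF u(2,3)], of a t] u
      by (simp add: card_Pow free_rows_def)
    finally show ?thesis using obtain_subset_with_card_n by metis
  qed
  then obtain E where E: "\<forall>u\<in>?R. E u \<subseteq> ?X u \<and> card (E u) = cap u" by metis
  define G where "G = tree_column m a t ` Sigma (Pow {..<m}) (\<lambda>S. insert m S)"
  define C where "C = G \<union> (\<Union>u\<in>?R. E u)"
  have fin: "finite D" if "D \<subseteq> columns m" for D using that finite_columns finite_subset by blast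
  have Gin: "G \<subseteq> columns m" unfolding G_def using tree_column_in by blast
  have Ein: "E u \<subseteq> columns m" if "u \<in> ?R" for u using E that extra_column_in by blast
  \<comment> \<open>Because no column is shared between pairs, all capacities can be filled
    independently and the sizes add up.\<close>
  have viol: "violates ?f x k l \<longleftrightarrow> u = (k, l)" if x: "u \<in> ?R" "x \<in> E u" and kl: "k < l" "l < m" for x u k l
  proof -
    obtain i j where u: "u = (i, j)" "i < j" "j < m" using x(1) unfolding R by auto
    have "x \<in> ?X u" using E x by blast
    then obtain U where "U \<subseteq> free_rows m a t i j" "x = extra_column m a t (i, j) U"
      unfolding u(1) by auto
    then show ?thesis using extra_column_violates_iff[OF at(1) u(2,3) _ kl, of U] u(1) by auto
  qed
  have Gviol: "\<not> violates ?f x k l" if "x \<in> G" "k < m" "l < m" "k \<noteq> l" for x k l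
    using that tree_column_not_violates[OF at(1)] unfolding G_def by auto
  have viol_set: "{x \<in> C. violates ?f x k l} = E (k, l)" if kl: "k < l" "l < m" for k l
  proof (intro subset_antisym subsetI)
    fix x assume x: "x \<in> {x \<in> C. violates ?f x k l}"
    then have "x \<notin> G" using Gviol[of x k l] kl by auto
    then obtain u where "u \<in> ?R" "x \<in> E u" using x unfolding C_def by blast
    moreover from this have "u = (k, l)" using viol[of u x k l] kl x by blast
    ultimately show "x \<in> E (k, l)" by simp
  next
    fix x assume x: "x \<in> E (k, l)"
    have "(k, l) \<in> ?R" using kl R by auto
    then have "violates ?f x k l" using viol[OF _ x kl] by blast
    moreover have "x \<in> C" using \<open>(k, l) \<in> ?R\<close> x unfolding C_def by blast
    ultimately show "x \<in> {x \<in> C. violates ?f x k l}" by simp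
  qed
  have "C \<subseteq> columns m" unfolding C_def using Gin Ein by blast
  moreover have "\<not> contains m (P + 1 - q) (P + 1) (P + 1) (P + 1 - q) C"
  proof
    assume "contains m (P + 1 - q) (P + 1) (P + 1) (P + 1 - q) C"
    then obtain i j where ij: "i < m" "j < m" "i \<noteq> j" "P + 1 - q \<le> pattern_count C i j 0 0"
      "P + 1 \<le> pattern_count C i j 1 0" "P + 1 \<le> pattern_count C i j 0 1" "P + 1 - q \<le> pattern_count C i j 1 1"
      unfolding contains_def by blast
    let ?u = "(min i j, max i j)"
    have u: "?u \<in> ?R" using ij R by auto
    have "violates ?f x (min i j) (max i j) = violates ?f x i j" for x
      using violates_sym[of ?f x i j] by (cases "i < j") auto
    then have "pattern_count C i j (of_bool (?f i j)) (of_bool (?f j i)) = cap ?u"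
      using E u viol_set[of "min i j" "max i j"] ij(1-3)
      unfolding pattern_count_def by (simp add: violates_def)
    moreover have "cap ?u = (if ?f i j = ?f j i then P - q else P)"
      unfolding cap_def unaligned_pairs_def using ij(1-3) by (cases "i < j") auto
    ultimately have "pattern_count C i j (of_bool (?f i j)) (of_bool (?f j i)) = (if ?f i j = ?f j i then P - q else P)"
      by simp
    then show False using ij(4-7) q by (cases "?f i j"; cases "?f j i") auto
  qed
  moreover have "card C + q * NN r = base m + P * (m choose 2)"
  proof -
    have "card C = card G + card (\<Union>u\<in>?R. E u)" unfolding C_def
    proof (rule card_Un_disjoint)
      show "G \<inter> (\<Union>u\<in>?R. E u) = {}"
      proof (rule ccontr)
        assume "G \<inter> (\<Union>u\<in>?R. E u) \<noteq> {}"
        then obtain x k l where "x \<in> G" "(k, l) \<in> ?R" "x \<in> E (k, l)" by auto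
        then show False using viol[of "(k, l)" x k l] Gviol[of x k l] unfolding R by auto
      qed
    qed (use Gin Ein finite_row_pairs fin in auto)
    also have "card (\<Union>u\<in>?R. E u) = (\<Sum>u\<in>?R. card (E u))"
    proof (rule card_UN_disjoint[OF finite_row_pairs])
      show "\<forall>u\<in>?R. finite (E u)" using fin Ein by blast
      show "\<forall>u\<in>?R. \<forall>v\<in>?R. u \<noteq> v \<longrightarrow> E u \<inter> E v = {}"
      proof (intro ballI impI, rule ccontr)
        fix u v assume uv: "u \<in> ?R" "v \<in> ?R" "u \<noteq> v" "E u \<inter> E v \<noteq> {}"
        then obtain x where x: "x \<in> E u" "x \<in> E v" by blast
        obtain k l where "u = (k, l)" "k < l" "l < m" using uv(1) unfolding R by auto
        then show False using viol[OF uv(1) x(1), of k l] viol[OF uv(2) x(2), of k l] uv(3) by simp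
      qed
    qed
    also have "\<dots> = (\<Sum>u\<in>?R. cap u)" using E by simp
    finally have "card C = base m + (\<Sum>u\<in>?R. cap u)" unfolding G_def card_tree_columns .
    moreover have "(\<Sum>u\<in>?R. cap u) + q * NN r = P * (m choose 2)"
    proof -
      have "?R \<inter> unaligned_pairs m ?f = unaligned_pairs m ?f" using unaligned_pairs_subset by blast
      then have "q * NN r = (\<Sum>u\<in>?R. if u \<in> unaligned_pairs m ?f then q else 0)"
        using finite_row_pairs card_unaligned_pairs_broom[OF at(1,2)] at(3)
        by (simp add: NN_def a_def b_def flip: sum.inter_restrict)
      then have "(\<Sum>u\<in>?R. cap u) + q * NN r = (\<Sum>u\<in>?R. cap u + (if u \<in> unaligned_pairs m ?f then q else 0))"
        by (simp add: sum.distrib)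
      also have "\<dots> = (\<Sum>u\<in>?R. P)" by (rule sum.cong) (use q in \<open>auto simp: cap_def\<close>)
      finally show ?thesis by (simp add: card_row_pairs)
    qed
    ultimately show ?thesis by simp
  qed
  ultimately show ?thesis by blast
qed

subsection \<open>The theorem\<close>

lemma ex_sparse_patterns:
  assumes "C \<subseteq> columns m" "q \<le> P" "\<not> contains m (P + 1 - q) (P + 1) (P + 1) (P + 1 - q) C"
  shows "\<exists>f. sparse_patterns m P q C f"
proof -
  let ?ok = "\<lambda>i j u v. pattern_count C i j (of_bool u) (of_bool v) \<le> (if u = v then P - q else P)"
  have "\<exists>uv. ?ok i j (fst uv) (snd uv)" if "i < m" "j < m" "i \<noteq> j" for i j
  proof -
    have "pattern_count C i j 0 0 < P + 1 - q \<or> pattern_count C i j 1 0 < P + 1 \<or>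
        pattern_count C i j 0 1 < P + 1 \<or> pattern_count C i j 1 1 < P + 1 - q"
      using assms(3) that unfolding contains_def by (meson not_le)
    then have "?ok i j False False \<or> ?ok i j True False \<or> ?ok i j False True \<or> ?ok i j True True"
      using assms(2) by auto
    then have "\<exists>u v. ?ok i j u v" by blast
    then show ?thesis by simp
  qed
  then have "\<forall>i j. \<exists>uv. i < m \<longrightarrow> j < m \<longrightarrow> i \<noteq> j \<longrightarrow> ?ok i j (fst uv) (snd uv)"
    by simp
  then obtain g where g: "\<forall>i j. i < m \<longrightarrow> j < m \<longrightarrow> i \<noteq> j \<longrightarrow> ?ok i j (fst (g i j)) (snd (g i j))"
    unfolding choice_iff by (elim exE)
  \<comment> \<open>Both orders of a pair must read the same choice, made for the increasing
    order.\<close>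
  define f where "f i j = (if i < j then fst (g i j) else snd (g j i))" for i j
  have less: "card {x \<in> C. violates f x i j} \<le> (if f i j = f j i then P - q else P)"
    if "i < j" "j < m" for i j
    using g that unfolding f_def violates_def pattern_count_def by (auto simp del: split_paired_All)
  have "sparse_patterns m P q C f"
  proof
    fix i j assume ij: "i < m" "j < m" "i \<noteq> j"
    show "card {x \<in> C. violates f x i j} \<le> (if f i j = f j i then P - q else P)"
    proof (cases "i < j")
      case True
      then show ?thesis using less ij by blast
    next
      case False
      then have "card {x \<in> C. violates f x j i} \<le> (if f j i = f i j then P - q else P)"
        using less[of j i] ij by simp
      moreover have "violates f x j i = violates f x i j" for x by (rule violates_sym)
      moreover have "(f j i = f i j) = (f i j = f j i)" by auto
      ultimately show ?thesis by (simp only:)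
    qed
  qed (use assms in auto)
  then show ?thesis by (rule exI[of _ f])
qed

lemma forb_Fmat_eq:
  assumes p: "2 \<le> p" "q \<le> p - 1" and m: "2 * NN r + 2 \<le> m"
    and r: "p - 1 \<le> 2 ^ r" "1 \<le> r \<Longrightarrow> 2 ^ (r - 1) < p - 1"
    and cond: "1 \<le> r \<Longrightarrow> 2 ^ (r - 1) + 2 * q \<le> p - 1 \<or>
        8 * (q * NN r) \<le> 2 ^ r \<and> 2 * q \<le> (r div 2 + 1) * (p - 1 - 2 ^ (r - 1))"
  shows "forb m 3 (Fmat (p - q) p p (p - q)) + q * NN r = base m + (p - 1) * (m choose 2)"
proof -
  have pp: "p - 1 + 1 = p" "p - 1 + 1 - q = p - q" using p by auto
  let ?F = "{C. C \<subseteq> columns m \<and> \<not> contains m (p - q) p p (p - q) C}"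
  have "r + 2 \<le> m" using m le_NN[of r] by linarith
  then obtain D where D: "D \<in> ?F" "card D + q * NN r = base m + (p - 1) * (m choose 2)"
    using ex_large_family[OF p(2) r(1), of m] unfolding pp by blast
  have upper: "card C + q * NN r \<le> base m + (p - 1) * (m choose 2)" if C: "C \<in> ?F" for C
  proof -
    obtain f where f: "sparse_patterns m (p - 1) q C f"
      using ex_sparse_patterns[of C m q "p - 1"] C p(2) unfolding pp by blast
    show ?thesis by (rule sparse_patterns.card_upper_bound[OF f r m cond])
  qed
  have "forb m 3 (Fmat (p - q) p p (p - q)) = Max (card ` ?F)"
    unfolding forb_def using ncols_Avoid_Fmat[of m] m by simp
  also have "\<dots> = card D"
  proof (rule Max_eqI)
    have "?F \<subseteq> Pow (columns m)" by blast
    moreover have "finite (Pow (columns m))" using finite_columns by simp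
    ultimately show "finite (card ` ?F)" by (intro finite_imageI) (rule finite_subset)
    show "k \<le> card D" if k: "k \<in> card ` ?F" for k
    proof -
      obtain C where "C \<in> ?F" "k = card C" using k by blast
      then show ?thesis using upper[of C] D(2) by linarith
    qed
    show "card D \<in> card ` ?F" using D(1) by blast
  qed
  finally show ?thesis using D(2) by (simp only:)
qed

lemma rr_bounds:
  assumes "2 \<le> p"
  shows "p - 1 \<le> 2 ^ rr p" "1 \<le> rr p \<Longrightarrow> 2 ^ (rr p - 1) < p - 1"
proof -
  let ?l = "log 2 (real p - 1)"
  have pos: "real p - 1 > 0" and P: "real (p - 1) = real p - 1" using assms by (auto simp: of_nat_diff)
  have e: "real p - 1 = 2 powr ?l" using pos by simp
  have "?l \<le> real (rr p)" unfolding rr_def by linarith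
  then have "2 powr ?l \<le> 2 powr real (rr p)" by (intro powr_mono) auto
  then have "real (p - 1) \<le> real (2 ^ rr p)" using e P by (simp add: powr_realpow)
  then show "p - 1 \<le> 2 ^ rr p" by (simp only: of_nat_le_iff)
  assume "1 \<le> rr p"
  then have "real (rr p) = of_int \<lceil>?l\<rceil>" unfolding rr_def by simp
  then have "real (rr p - 1) < ?l" using \<open>1 \<le> rr p\<close> by (simp add: of_nat_diff) linarith
  then have "2 powr real (rr p - 1) < 2 powr ?l" by simp
  then have "real (2 ^ (rr p - 1)) < real (p - 1)" using e P by (simp add: powr_realpow)
  then show "2 ^ (rr p - 1) < p - 1" by (simp only: of_nat_less_iff)
qed

lemma forb_Fmat_eq_forb_pK2:
  assumes p: "2 \<le> p" "q \<le> p - 1" and m: "2 * NN (rr p) + 2 \<le> m"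
    and cond: "1 \<le> rr p \<Longrightarrow> 2 ^ (rr p - 1) + 2 * q \<le> p - 1 \<or>
        8 * (q * NN (rr p)) \<le> 2 ^ rr p \<and> 2 * q \<le> (rr p div 2 + 1) * (p - 1 - 2 ^ (rr p - 1))"
  shows "int (forb m 3 (Fmat (p - q) p p (p - q))) = int (forb m 3 (pK2 p)) - int (q * NN (rr p))"
proof -
  have "forb m 3 (Fmat (p - q) p p (p - q)) + q * NN (rr p) = base m + (p - 1) * (m choose 2)"
    using forb_Fmat_eq[OF p m rr_bounds[OF p(1)] cond] .
  \<comment> \<open>The value for \<open>pK2 p\<close> is the case \<open>q = 0\<close>, where
    condition (i) is just \<open>2 ^ (rr p - 1) \<le> p - 1\<close>.\<close>
  moreover have "forb m 3 (Fmat (p - 0) p p (p - 0)) + 0 * NN (rr p) = base m + (p - 1) * (m choose 2)"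
    by (rule forb_Fmat_eq[OF p(1) _ m rr_bounds[OF p(1)]]) (use rr_bounds(2)[OF p(1)] in auto)
  ultimately have "forb m 3 (Fmat (p - q) p p (p - q)) + q * NN (rr p) = forb m 3 (pK2 p)"
    unfolding forb_pK2 by simp
  then have "int (forb m 3 (Fmat (p - q) p p (p - q)) + q * NN (rr p)) = int (forb m 3 (pK2 p))"
    by (rule arg_cong)
  then show ?thesis unfolding of_nat_add by linarith
qed

section \<open>Fixed \<open>q\<close> and large \<open>p\<close>, and the conditions in natural
  numbers\<close>

lemma NN_le: "NN r \<le> 2 * (r + 1) ^ 2"
proof -
  have c: "n choose 2 \<le> (r + 1) ^ 2" if "n \<le> r + 1" for n
  proof -
    have "n choose 2 \<le> n * (n - 1)" unfolding choose_two by simp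
    also have "\<dots> \<le> (r + 1) * (r + 1)" using that by (intro mult_le_mono) auto
    finally show ?thesis by (simp add: power2_eq_square)
  qed
  have "((r + 1) div 2 + 1 choose 2) \<le> (r + 1) ^ 2" "(r div 2 + 1 choose 2) \<le> (r + 1) ^ 2"
    by (intro c; cases "r = 0"; simp)+
  then show ?thesis unfolding NN_def by linarith
qed

lemma eventually_NN_le: "\<exists>r0. \<forall>r\<ge>r0. 8 * (q * NN r) \<le> 2 ^ r"
proof -
  \<comment> \<open>The ratio \<open>1 / sqrt 2\<close> is chosen because squaring turns this limit
    into that of \<open>n ^ 2 / 2 ^ n\<close>.\<close>
  have "(\<lambda>n. of_nat n * (1 / sqrt 2) ^ n) \<longlonglongrightarrow> (0::real)"
    by (rule powser_times_n_limit_0) simp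
  then have "(\<lambda>n. (of_nat n * (1 / sqrt 2) ^ n) ^ 2) \<longlonglongrightarrow> (0::real) ^ 2"
    by (rule tendsto_power)
  then have "(\<lambda>r. 2 * (of_nat (Suc r) * (1 / sqrt 2) ^ Suc r) ^ 2) \<longlonglongrightarrow> 2 * (0::real) ^ 2"
    by (intro tendsto_mult tendsto_const LIMSEQ_Suc)
  moreover have "2 * (of_nat (Suc r) * (1 / sqrt 2) ^ Suc r) ^ 2 = (real r + 1) ^ 2 / 2 ^ r" for r
  proof -
    have "((1 / sqrt 2) ^ Suc r) ^ 2 = (1 / 2) ^ Suc r"
      by (subst power_mult[symmetric], subst mult.commute, subst power_mult) (simp add: power_divide)
    then show ?thesis by (simp add: power_mult_distrib power_divide add.commute)
  qed
  ultimately have "(\<lambda>r::nat. (real r + 1) ^ 2 / 2 ^ r) \<longlonglongrightarrow> 2 * 0 ^ 2" by (simp only:)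
  then have "(\<lambda>r::nat. (real r + 1) ^ 2 / 2 ^ r) \<longlonglongrightarrow> 0" by simp
  \<comment> \<open>The factor 16 is 8 times the 2 of \<open>NN_le\<close>; adding 1 keeps the
    denominator positive for \<open>q = 0\<close>.\<close>
  then have "eventually (\<lambda>r::nat. (real r + 1) ^ 2 / 2 ^ r < 1 / (16 * real q + 1)) sequentially"
    by (rule order_tendstoD) simp
  then obtain r0 where r0: "\<forall>r\<ge>r0. (real r + 1) ^ 2 / 2 ^ r < 1 / (16 * real q + 1)"
    unfolding eventually_sequentially by (elim exE)
  have "8 * (q * NN r) \<le> 2 ^ r" if "r \<ge> r0" for r
  proof -
    have "(real r + 1) ^ 2 * (16 * real q + 1) < 2 ^ r" using r0[rule_format, OF that] by (simp add: field_simps)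
    moreover have "16 * real q * (real r + 1) ^ 2 \<le> (real r + 1) ^ 2 * (16 * real q + 1)" by (simp add: algebra_simps)
    ultimately have "16 * real q * (real r + 1) ^ 2 \<le> 2 ^ r" by linarith
    then have "real (16 * q * (r + 1) ^ 2) \<le> real (2 ^ r)" by (simp add: add.commute)
    then have "16 * q * (r + 1) ^ 2 \<le> 2 ^ r" by (simp only: of_nat_le_iff)
    moreover have "8 * (q * NN r) \<le> 8 * (q * (2 * (r + 1) ^ 2))" by (intro mult_le_mono order_refl NN_le)
    moreover have "8 * (q * (2 * (r + 1) ^ 2)) = 16 * q * (r + 1) ^ 2" by simp
    ultimately show ?thesis by linarith
  qed
  then show ?thesis by blast
qed

lemma nat_condition:
  assumes p: "2 \<le> p" and r: "1 \<le> rr p"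
    and cond: "real p \<ge> 2 powi (int (rr p) - 1) + 2 * real q + 1 \<or>
             (real p \<le> 2 powi (int (rr p) - 1) + 2 * real q \<and>
              real (q * NN (rr p)) \<le> 2 powi (int (rr p) - 3) \<and>
              1/2 * (real (rr p div 2) + 1) * (real p - 1 - 2 powi (int (rr p) - 1)) \<ge> real q)"
  shows "2 ^ (rr p - 1) + 2 * q \<le> p - 1 \<or>
        8 * (q * NN (rr p)) \<le> 2 ^ rr p \<and> 2 * q \<le> (rr p div 2 + 1) * (p - 1 - 2 ^ (rr p - 1))"
proof -
  let ?r = "rr p"
  have "int ?r - 1 = int (?r - 1)" using r by simp
  then have e1: "2 powi (int ?r - 1) = real (2 ^ (?r - 1))" by (simp only: power_int_of_nat) simp
  \<comment> \<open>For \<open>?r < 3\<close> the exponent is negative, so the inequality passes to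
    natural numbers only after multiplication by 8.\<close>
  have e3: "8 * 2 powi (int ?r - 3) = real (2 ^ ?r)" by (simp add: power_int_diff)
  have lt: "2 ^ (?r - 1) < p - 1" by (rule rr_bounds(2)[OF p r])
  then have d: "real (p - 1 - 2 ^ (?r - 1)) = real p - 1 - real (2 ^ (?r - 1))"
    using p by (simp add: of_nat_diff)
  from cond show ?thesis
  proof (elim disjE conjE)
    assume "real p \<ge> 2 powi (int ?r - 1) + 2 * real q + 1"
    then have "real (2 ^ (?r - 1) + 2 * q + 1) \<le> real p" unfolding e1 by simp
    then have "2 ^ (?r - 1) + 2 * q + 1 \<le> p" by (simp only: of_nat_le_iff)
    then have "2 ^ (?r - 1) + 2 * q \<le> p - 1" by linarith
    then show ?thesis ..
  next
    assume h: "real (q * NN ?r) \<le> 2 powi (int ?r - 3)"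
      "1/2 * (real (?r div 2) + 1) * (real p - 1 - 2 powi (int ?r - 1)) \<ge> real q"
    have "real (8 * (q * NN ?r)) \<le> real (2 ^ ?r)" unfolding e3[symmetric] using h(1) by simp
    moreover have "real (2 * q) \<le> real ((?r div 2 + 1) * (p - 1 - 2 ^ (?r - 1)))"
      using h(2) unfolding e1 of_nat_mult d by (simp add: mult.commute add.commute)
    ultimately show ?thesis by (simp only: of_nat_le_iff) blast
  qed
qed

theorem mainTheorem3:
  shows "(\<forall>p q m. p \<ge> 2 \<longrightarrow> q \<le> p - 1 \<longrightarrow> m \<ge> 2 * NN (rr p) + 2 \<longrightarrow>
            (real p \<ge> 2 powi (int (rr p) - 1) + 2 * real q + 1 \<or>
             (real p \<le> 2 powi (int (rr p) - 1) + 2 * real q \<and>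
              real (q * NN (rr p)) \<le> 2 powi (int (rr p) - 3) \<and>
              1/2 * (real (rr p div 2) + 1) * (real p - 1 - 2 powi (int (rr p) - 1)) \<ge> real q))
            \<longrightarrow> int (forb m 3 (Fmat (p - q) p p (p - q)))
                  = int (forb m 3 (pK2 p)) - int (q * NN (rr p)))
       \<and> (\<forall>q. \<exists>P. \<forall>p m. p \<ge> P \<longrightarrow> m \<ge> 2 * NN (rr p) + 2 \<longrightarrow>
            int (forb m 3 (Fmat (p - q) p p (p - q)))
              = int (forb m 3 (pK2 p)) - int (q * NN (rr p)))"
proof (intro conjI allI impI)
  fix p q m :: nat
  assume "p \<ge> 2" "q \<le> p - 1" "m \<ge> 2 * NN (rr p) + 2"
    "real p \<ge> 2 powi (int (rr p) - 1) + 2 * real q + 1 \<or>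
             (real p \<le> 2 powi (int (rr p) - 1) + 2 * real q \<and>
              real (q * NN (rr p)) \<le> 2 powi (int (rr p) - 3) \<and>
              1/2 * (real (rr p div 2) + 1) * (real p - 1 - 2 powi (int (rr p) - 1)) \<ge> real q)"
  then show "int (forb m 3 (Fmat (p - q) p p (p - q))) = int (forb m 3 (pK2 p)) - int (q * NN (rr p))"
    by (intro forb_Fmat_eq_forb_pK2 nat_condition)
next
  fix q :: nat
  obtain r0 where r0: "\<forall>r\<ge>r0. 8 * (q * NN r) \<le> 2 ^ r" using eventually_NN_le[of q] by (elim exE)
  show "\<exists>P. \<forall>p m. p \<ge> P \<longrightarrow> m \<ge> 2 * NN (rr p) + 2 \<longrightarrow>
            int (forb m 3 (Fmat (p - q) p p (p - q)))
              = int (forb m 3 (pK2 p)) - int (q * NN (rr p))"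
  proof (intro exI allI impI)
    \<comment> \<open>The power forces \<open>rr p > r0 + 4 * q\<close>: then \<open>r0\<close>
      gives the first inequality of (ii), and \<open>rr p div 2 + 1 \<ge> 2 * q\<close> gives the
      second, as \<open>p - 1 - 2 ^ (rr p - 1) \<ge> 1\<close>. The term \<open>q + 2\<close>
      secures \<open>2 \<le> p\<close> and \<open>q \<le> p - 1\<close>.\<close>
    fix p m assume p: "2 ^ (r0 + 4 * q) + q + 2 \<le> p" and m: "m \<ge> 2 * NN (rr p) + 2"
    have p2: "2 \<le> p" using p by simp
    have "(2::nat) ^ (r0 + 4 * q) < 2 ^ rr p" using rr_bounds(1)[OF p2] p by linarith
    then have r: "r0 + 4 * q < rr p" by simp
    show "int (forb m 3 (Fmat (p - q) p p (p - q))) = int (forb m 3 (pK2 p)) - int (q * NN (rr p))"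
    proof (rule forb_Fmat_eq_forb_pK2[OF p2 _ m])
      have "2 * q \<le> (rr p div 2 + 1) * 1" using r by simp
      also have "\<dots> \<le> (rr p div 2 + 1) * (p - 1 - 2 ^ (rr p - 1))"
        using rr_bounds(2)[OF p2] r by (intro mult_le_mono order_refl) simp
      finally show "2 ^ (rr p - 1) + 2 * q \<le> p - 1 \<or>
        8 * (q * NN (rr p)) \<le> 2 ^ rr p \<and> 2 * q \<le> (rr p div 2 + 1) * (p - 1 - 2 ^ (rr p - 1))"
        using r0[rule_format, of "rr p"] r by simp
    qed (use p in simp)
  qed
qed

end
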